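(* Let $H \subseteq_i P_2 + 2P_1$, $P_3 + P_1$, or $P_4$. Then Diameter on $H$-free graphs can be solved in $O(n+m)$ time.
   Context: Graphs are connected, undirected and unweighted; $n$ is the number of vertices and $m$ the number of edges. A graph is $H$-free if it does not contain $H$ as an induced subgraph. $H \subseteq_i H'$ means $H$ is an induced subgraph of $H'$. $P_t$ denotes the path on $t$ vertices, $sP_t$ the disjoint union of $s$ copies of $P_t$, and $G+H$ the disjoint union of graphs $G$ and $H$. The Diameter problem asks for the diameter of a given connected graph, i.e. the maximum over all vertex pairs of their shortest-path distance. *)

theory Defs
  imports "Graph_Theory.Graph_Theory"
begin

section \<open>Graphs\<close>

text \<open>
  A simple undirected graph is a symmetric loopless \<^typ>\<open>'a pair_pre_digraph\<close> with finitely
  many vertices (locale \<^locale>\<open>pair_graph\<close>); an edge is a pair of opposite arcs.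
\<close>

definition edges :: "'a pair_pre_digraph \<Rightarrow> 'a set set" where
  "edges G = (\<lambda>(u, v). {u, v}) ` parcs G"

definition path_graph :: "nat \<Rightarrow> nat pair_pre_digraph" where
  "path_graph t = \<lparr>pverts = {..<t},
     parcs = {(i, j). i < t \<and> j < t \<and> (j = Suc i \<or> i = Suc j)}\<rparr>"

definition disj_union ::
    "'a pair_pre_digraph \<Rightarrow> 'b pair_pre_digraph \<Rightarrow> ('a + 'b) pair_pre_digraph" where
  "disj_union G H = \<lparr>pverts = pverts G <+> pverts H,
     parcs = map_prod Inl Inl ` parcs G \<union> map_prod Inr Inr ` parcs H\<rparr>"

definition copies :: "nat \<Rightarrow> 'a pair_pre_digraph \<Rightarrow> (nat \<times> 'a) pair_pre_digraph" where
  "copies s G = \<lparr>pverts = {..<s} \<times> pverts G,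
     parcs = {((i, u), (i, v)) |i u v. i < s \<and> (u, v) \<in> parcs G}\<rparr>"

text \<open>Containment as an induced subgraph is meant up to isomorphism.\<close>

definition induced_in :: "'a pair_pre_digraph \<Rightarrow> 'b pair_pre_digraph \<Rightarrow> bool" where
  "induced_in H G \<longleftrightarrow>
     (\<exists>H'. induced_subgraph H' (with_proj G) \<and> digraph_iso (with_proj H) H')"

definition induced_free :: "'a pair_pre_digraph \<Rightarrow> 'b pair_pre_digraph \<Rightarrow> bool" where
  "induced_free H G \<longleftrightarrow> \<not> induced_in H G"

definition distance :: "'a pair_pre_digraph \<Rightarrow> 'a \<Rightarrow> 'a \<Rightarrow> ereal" where
  "distance G u v = wf_digraph.\<mu> (with_proj G) (\<lambda>_. 1) u v"

definition diameter :: "'a pair_pre_digraph \<Rightarrow> ereal" where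
  "diameter G = Max {distance G u v |u v. u \<in> pverts G \<and> v \<in> pverts G}"


section \<open>A word RAM\<close>

text \<open>
  Unit-cost random access machine, programmed in a structured language. A program mentions
  finitely many registers and finitely many arrays; arrays are unbounded, and are addressed
  by the content of a register. The only arithmetic is addition and truncated subtraction.
\<close>

record ram_state =
  reg :: "nat \<Rightarrow> nat"
  arr :: "nat \<Rightarrow> nat \<Rightarrow> nat"

datatype cond = Less nat nat | Eq nat nat | Neg cond

datatype com =
    Skip
  | Const nat nat
  | Move nat nat
  | Add nat nat nat
  | Sub nat nat nat
  | Load nat nat nat  \<comment> \<open>\<open>Load x a i\<close>: register \<open>x\<close> receives the entry of array \<open>a\<close> at the address in register \<open>i\<close>\<close>
  | Store nat nat nat \<comment> \<open>\<open>Store a i x\<close>: the entry of array \<open>a\<close> at the address in register \<open>i\<close> receives register \<open>x\<close>\<close>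
  | Seq com com
  | If cond com com
  | While cond com

fun holds :: "cond \<Rightarrow> ram_state \<Rightarrow> bool" where
  "holds (Less x y) s \<longleftrightarrow> reg s x < reg s y"
| "holds (Eq x y) s \<longleftrightarrow> reg s x = reg s y"
| "holds (Neg b) s \<longleftrightarrow> \<not> holds b s"

definition set_reg :: "nat \<Rightarrow> nat \<Rightarrow> ram_state \<Rightarrow> ram_state" where
  "set_reg x k s = s\<lparr>reg := (reg s)(x := k)\<rparr>"

definition set_arr :: "nat \<Rightarrow> nat \<Rightarrow> nat \<Rightarrow> ram_state \<Rightarrow> ram_state" where
  "set_arr a i k s = s\<lparr>arr := (arr s)(a := (arr s a)(i := k))\<rparr>"

text \<open>
  \<open>exec W c s t s'\<close>: started in \<open>s\<close>, program \<open>c\<close> halts in \<open>s'\<close> after \<open>t\<close> steps. \<open>W\<close> is the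
  largest number fitting into a machine word: an instruction producing a larger number has no
  successor state, so a run that overflows does not count as halting.
\<close>

inductive exec :: "nat \<Rightarrow> com \<Rightarrow> ram_state \<Rightarrow> nat \<Rightarrow> ram_state \<Rightarrow> bool" for W :: nat where
  Skip: "exec W Skip s 1 s"
| Const: "k \<le> W \<Longrightarrow> exec W (Const x k) s 1 (set_reg x k s)"
| Move: "exec W (Move x y) s 1 (set_reg x (reg s y) s)"
| Add: "reg s y + reg s z \<le> W \<Longrightarrow> exec W (Add x y z) s 1 (set_reg x (reg s y + reg s z) s)"
| Sub: "exec W (Sub x y z) s 1 (set_reg x (reg s y - reg s z) s)"
| Load: "exec W (Load x a i) s 1 (set_reg x (arr s a (reg s i)) s)"
| Store: "exec W (Store a i x) s 1 (set_arr a (reg s i) (reg s x) s)"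
| Seq: "exec W c1 s t1 s' \<Longrightarrow> exec W c2 s' t2 s'' \<Longrightarrow> exec W (Seq c1 c2) s (t1 + t2) s''"
| IfTrue: "holds b s \<Longrightarrow> exec W c1 s t s' \<Longrightarrow> exec W (If b c1 c2) s (1 + t) s'"
| IfFalse: "\<not> holds b s \<Longrightarrow> exec W c2 s t s' \<Longrightarrow> exec W (If b c1 c2) s (1 + t) s'"
| WhileFalse: "\<not> holds b s \<Longrightarrow> exec W (While b c) s 1 s"
| WhileTrue: "holds b s \<Longrightarrow> exec W c s t1 s' \<Longrightarrow> exec W (While b c) s' t2 s'' \<Longrightarrow>
    exec W (While b c) s (1 + t1 + t2) s''"

lemma exec_deterministic:
  "exec W c s t s' \<Longrightarrow> exec W c s u r \<Longrightarrow> u = t \<and> r = s'"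
proof (induction arbitrary: u r rule: exec.induct)
  case (WhileTrue b s c t1 s' t2 s'')
  from WhileTrue.prems WhileTrue.hyps(1) obtain u1 r' u2 where
    "exec W c s u1 r'" "exec W (While b c) r' u2 r" "u = 1 + u1 + u2"
    by (cases rule: exec.cases) auto
  then show ?case using WhileTrue.IH by blast
next
  case (Seq c1 s t1 s' c2 t2 s'')
  from Seq.prems obtain u1 r' u2 where
    "exec W c1 s u1 r'" "exec W c2 r' u2 r" "u = u1 + u2"
    by (cases rule: exec.cases) auto
  then show ?case using Seq.IH by blast
qed (erule exec.cases; auto)+


section \<open>Solving Diameter in linear time\<close>

text \<open>
  Input format: adjacency lists in arbitrary order, on vertices \<open>0, \<dots>, n - 1\<close>. They are stored
  one after the other in array 1, the list of \<open>v\<close> occupying the addresses from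
  \<open>arr s 0 v\<close> up to, but excluding, \<open>arr s 0 (v + 1)\<close>; register 0 holds \<open>n\<close>, and all other
  memory is 0. The answer is returned in register 0.
\<close>

definition adjacency_lists :: "nat pair_pre_digraph \<Rightarrow> nat list list \<Rightarrow> bool" where
  "adjacency_lists G adj \<longleftrightarrow> pverts G = {..<length adj} \<and>
     (\<forall>v<length adj. distinct (adj ! v) \<and> set (adj ! v) = {w. (v, w) \<in> parcs G})"

definition input_state :: "nat list list \<Rightarrow> ram_state" where
  "input_state adj = \<lparr>
     reg = (\<lambda>_. 0)(0 := length adj),
     arr = (\<lambda>_ _. 0)
       (0 := (\<lambda>v. if v \<le> length adj then length (concat (take v adj)) else 0),
        1 := (\<lambda>i. if i < length (concat adj) then concat adj ! i else 0))\<rparr>"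

text \<open>
  The word bound \<open>(n + m + 2) ^ k\<close> amounts to words of \<open>O(log (n + m))\<close> bits.
\<close>

definition diameter_in_linear_time :: "(nat pair_pre_digraph \<Rightarrow> bool) \<Rightarrow> bool" where
  "diameter_in_linear_time C \<longleftrightarrow>
     (\<exists>prog c k. \<forall>G adj. pair_graph G \<longrightarrow> connected (with_proj G) \<longrightarrow> C G \<longrightarrow>
        adjacency_lists G adj \<longrightarrow>
        (let n = card (pverts G); m = card (edges G) in
          \<exists>t s'. exec ((n + m + 2) ^ k) prog (input_state adj) t s' \<and>
            t \<le> c * (n + m) \<and> ereal (real (reg s' 0)) = diameter G))"

end

theory Submission
  imports Defs
begin

text \<open>
  The distance between two vertices is at most 4 in all three classes. Let \<open>x\<close> be a vertex of minimum
  degree. In a \<open>P\<^sub>4\<close>-free graph all distances are at most 2. In a \<open>(P\<^sub>3 + P\<^sub>1)\<close>-free graph two vertices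
  \<open>u\<close>, \<open>v\<close> at distance at least 3 have cliques as closed neighbourhoods, which cover the graph, and \<open>x\<close> has
  no neighbour outside its clique; so \<open>x\<close> has maximum eccentricity. The same holds for a
  \<open>(P\<^sub>2 + 2P\<^sub>1)\<close>-free graph if \<open>u\<close> and \<open>v\<close> have distance 4, as then \<open>x\<close> must be \<open>u\<close> or \<open>v\<close>. If the diameter of such a graph is 3,
  but the eccentricity of \<open>x\<close> is 2, then \<open>x\<close> is a neighbour of, say, \<open>u\<close>. The common non-neighbours of \<open>x\<close>
  and \<open>u\<close> form a clique, in which \<open>v\<close> is the unique vertex with fewest neighbours outside the closed
  neighbourhood of \<open>x\<close>. So for every neighbour \<open>u\<close> of \<open>x\<close> there is only one candidate \<open>v\<close>, which is
  found and tested in time \<open>O(n)\<close>. Since \<open>x\<close> has minimum degree, this takes time \<open>O(n + m)\<close> in total.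
\<close>

section \<open>Distances and minimum degree vertices\<close>

text \<open>A search from every vertex is too slow, while one search from \<open>x\<close> can be
  wrong: it may report 2 where the diameter is 3, though only without P2 + 2P1. Looking for a far
  pair repairs exactly this case. It is affordable by counting: \<open>n\<close> times the minimum
  degree is at most the sum of all degrees, which is twice the number of edges. One program serves
  all three classes. This is safe because a candidate \<open>v\<close> is tested rather than
  trusted: a passed test exhibits a pair at distance above 2 in every connected graph. The classes
  enter only through the distance bound 4 and the guarantee that far pairs are detected, both
  recorded in \<open>tractable\<close>.\<close>

context pair_graph
begin

abbreviation nbrs :: "'a \<Rightarrow> 'a set" where
  "nbrs u \<equiv> {v. (u, v) \<in> parcs G}"

text \<open>Recursion on \<open>k\<close> avoids walks: for \<open>k\<close> up to 4 the predicate
  unfolds to plain statements about arcs.\<close>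

primrec near :: "nat \<Rightarrow> 'a \<Rightarrow> 'a \<Rightarrow> bool" where
  "near 0 u v \<longleftrightarrow> u = v"
| "near (Suc k) u v \<longleftrightarrow> near k u v \<or> (\<exists>z. near k u z \<and> (z, v) \<in> parcs G)"

definition outer_degree :: "'a \<Rightarrow> 'a \<Rightarrow> nat" where
  "outer_degree x z = card (nbrs z - nbrs x - {x})"

text \<open>The minimum is required to be strict, so that every search for a minimiser of
  \<open>outer_degree\<close> among the common non-neighbours of \<open>x\<close> and
  \<open>u\<close> ends at this \<open>v\<close>.\<close>

definition certificate :: "'a \<Rightarrow> 'a \<Rightarrow> bool" where
  "certificate x u \<longleftrightarrow> (\<exists>v. v \<in> pverts G - nbrs x - {x} - nbrs u - {u} \<and>
     (\<forall>z \<in> pverts G - nbrs x - {x} - nbrs u - {u}. z \<noteq> v \<longrightarrow> outer_degree x v < outer_degree x z) \<and>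
     \<not> near 2 u v)"

lemma parcs_sym: "(u, v) \<in> parcs G \<longleftrightarrow> (v, u) \<in> parcs G"
  using graph_symmetric by blast

lemma no_loop: "(u, u) \<notin> parcs G"
  using pair_no_loops[of "(u, u)"] by auto

lemma finite_nbrs: "finite (nbrs u)"
  by (rule finite_subset[OF _ pair_finite_verts]) (auto dest: in_arcsD2)

lemma nbrs_subset: "nbrs u \<subseteq> pverts G"
  by (auto dest: in_arcsD2)

lemma near_mono: "near k u v \<Longrightarrow> k \<le> l \<Longrightarrow> near l u v"
  by (induction l) (auto simp: le_Suc_eq)

lemma near_trans: "near k u v \<Longrightarrow> near l v w \<Longrightarrow> near (k + l) u w"
  by (induction l arbitrary: w) auto

lemma near_1: "near (Suc 0) u v \<longleftrightarrow> u = v \<or> (u, v) \<in> parcs G"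
  by auto

lemma near_sym: "near k u v \<Longrightarrow> near k v u"
proof (induction k arbitrary: v)
  case (Suc k)
  from Suc.prems consider "near k u v" | z where "near k u z" "(z, v) \<in> parcs G" by auto
  then show ?case
  proof cases
    case 1
    then show ?thesis using Suc.IH by simp
  next
    case 2
    then have "near (Suc 0) v z" "near k z u" using Suc.IH parcs_sym by (auto simp: near_1)
    from near_trans[OF this] show ?thesis by simp
  qed
qed simp

lemma near_commute: "near k u v \<longleftrightarrow> near k v u"
  using near_sym by blast

lemma near_2: "near 2 u v \<longleftrightarrow> u = v \<or> (u, v) \<in> parcs G \<or> (\<exists>z. (u, z) \<in> parcs G \<and> (z, v) \<in> parcs G)"
  by (auto simp: numeral_2_eq_2)

lemma near_3: "near 3 u v \<longleftrightarrow> near 2 u v \<or> (\<exists>z. near 2 u z \<and> (z, v) \<in> parcs G)"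
  by (auto simp: eval_nat_numeral)

lemma near_4: "near 4 u v \<longleftrightarrow> near 3 u v \<or> (\<exists>z. near 3 u z \<and> (z, v) \<in> parcs G)"
  by (auto simp: eval_nat_numeral)

lemma far_2:
  assumes "\<not> near 2 u v"
  shows "u \<noteq> v" "(u, v) \<notin> parcs G" "(v, u) \<notin> parcs G"
    and "\<And>z. (u, z) \<in> parcs G \<Longrightarrow> (z, v) \<notin> parcs G" "\<And>z. (u, z) \<in> parcs G \<Longrightarrow> (v, z) \<notin> parcs G"
    and "\<And>z. (z, u) \<in> parcs G \<Longrightarrow> (z, v) \<notin> parcs G" "\<And>z. (z, u) \<in> parcs G \<Longrightarrow> (v, z) \<notin> parcs G"
  using assms parcs_sym by (auto simp: near_2)

text \<open>A neighbour of \<open>v\<close> is still more than 2 away from \<open>u\<close>, so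
  \<open>far_2\<close> applies to it.\<close>

lemma far_3:
  assumes "\<not> near 3 u v" "(u, a) \<in> parcs G" "(v, b) \<in> parcs G"
  shows "a \<noteq> b" "(a, b) \<notin> parcs G" "(b, a) \<notin> parcs G"
proof -
  have "near (Suc 0) b v" using assms(3) parcs_sym by (simp add: near_1)
  then have "\<not> near 2 u b" using near_trans[of 2 u b "Suc 0" v] assms(1) by auto
  then show "a \<noteq> b" "(a, b) \<notin> parcs G" "(b, a) \<notin> parcs G" using far_2[of u b] assms(2) by auto
qed

text \<open>An inclusion of finite sets whose cardinalities compare the other way is an equality. In
  this form minimality of the degree of \<open>x\<close> yields structure.\<close>

lemma closed_nbrs_converse:
  assumes sub: "insert u (nbrs u) \<subseteq> insert x (nbrs x)" and le: "card (nbrs x) \<le> card (nbrs u)"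
    and y: "(x, y) \<in> parcs G"
  shows "y = u \<or> (u, y) \<in> parcs G"
proof -
  have "card (insert x (nbrs x)) \<le> card (insert u (nbrs u))"
    using le finite_nbrs no_loop by simp
  from card_seteq[OF _ sub this] have "insert x (nbrs x) \<subseteq> insert u (nbrs u)"
    using finite_nbrs by simp
  then show ?thesis using y by blast
qed

end

section \<open>Connectivity, walks and the diameter\<close>

locale connected_pair_graph = pair_graph +
  assumes conn: "connected (with_proj G)"
begin

lemma pverts_nonempty: "pverts G \<noteq> {}"
  using conn by (auto simp: connected_def strongly_connected_def)

text \<open>Connectivity as an induction principle: symmetry makes the graph strongly connected, and
  closure under arcs carries membership along a walk. Contradictions to connectivity are later
  obtained by applying this to a suitable set.\<close>

lemma closed_eq_pverts:
  assumes "S \<subseteq> pverts G" "S \<noteq> {}" "\<And>u v. u \<in> S \<Longrightarrow> (u, v) \<in> parcs G \<Longrightarrow> v \<in> S"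
  shows "S = pverts G"
proof -
  obtain u where u: "u \<in> S" using assms(2) by auto
  have "strongly_connected (with_proj G)"
    by (rule symmetric_connected_imp_strongly_connected[OF pair_sym_arcs conn])
  have "v \<in> S" if "v \<in> pverts G" for v
  proof -
    have "u \<rightarrow>\<^sup>*\<^bsub>with_proj G\<^esub> v"
      using \<open>strongly_connected (with_proj G)\<close> that u assms(1) by (auto simp: strongly_connected_def)
    then show ?thesis using u assms(3)
      by (induction rule: reachable_induct) auto
  qed
  then show ?thesis using assms(1) by auto
qed

lemma ex_near:
  assumes "u \<in> pverts G" "v \<in> pverts G"
  shows "\<exists>k. near k u v"
proof -
  have "{v \<in> pverts G. \<exists>k. near k u v} = pverts G"
  proof (rule closed_eq_pverts)
    show "{v \<in> pverts G. \<exists>k. near k u v} \<noteq> {}" using assms(1) near.simps(1) by blast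
    fix a b assume "a \<in> {v \<in> pverts G. \<exists>k. near k u v}" "(a, b) \<in> parcs G"
    then show "b \<in> {v \<in> pverts G. \<exists>k. near k u v}"
      using near.simps(2) in_arcsD2 by blast
  qed auto
  then show ?thesis using assms by blast
qed

lemma nbrs_nonempty:
  assumes "u \<in> pverts G" "v \<in> pverts G" "u \<noteq> v"
  shows "nbrs u \<noteq> {}"
proof
  assume "nbrs u = {}"
  then have "{u} = pverts G" using assms(1) by (intro closed_eq_pverts) auto
  then show False using assms by auto
qed

text \<open>The empty walk exists only at a vertex of the graph, whereas \<open>near 0 u u\<close>
  holds for every \<open>u\<close>; hence the hypothesis.\<close>

lemma near_iff_awalk:
  assumes "u \<in> pverts G"
  shows "near k u v \<longleftrightarrow> (\<exists>p. awalk u p v \<and> length p \<le> k)"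
proof
  show "near k u v \<Longrightarrow> \<exists>p. awalk u p v \<and> length p \<le> k"
  proof (induction k arbitrary: v)
    case 0
    then show ?case using assms by (intro exI[of _ "[]"]) (simp add: awalk_Nil_iff)
  next
    case (Suc k)
    from Suc.prems consider "near k u v" | z where "near k u z" "(z, v) \<in> parcs G" by auto
    then show ?case
    proof cases
      case 1
      then show ?thesis using Suc.IH le_Suc_eq by blast
    next
      case 2
      then obtain p where p: "awalk u p z" "length p \<le> k" using Suc.IH by blast
      have "awalk z [(z, v)] v" using arc_implies_awalk[OF 2(2)] by simp
      with p show ?thesis by (intro exI[of _ "p @ [(z, v)]"]) auto
    qed
  qed
next
  assume "\<exists>p. awalk u p v \<and> length p \<le> k"
  then obtain p where p: "awalk u p v" "length p \<le> k" by blast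
  from p(1) have "near (length p) u v"
  proof (induction p arbitrary: u)
    case Nil
    then show ?case by (simp add: awalk_Nil_iff)
  next
    case (Cons e p)
    have "near (Suc 0) u (snd e)" "near (length p) (snd e) v"
      using Cons.prems Cons.IH[of "snd e"] by (cases e; auto simp: awalk_Cons_iff)+
    from near_trans[OF this] show ?case by simp
  qed
  then show "near k u v" using p(2) near_mono by blast
qed

definition hops :: "'a \<Rightarrow> 'a \<Rightarrow> nat" where
  "hops u v = (LEAST k. near k u v)"

lemma near_iff_hops:
  assumes "u \<in> pverts G" "v \<in> pverts G"
  shows "near k u v \<longleftrightarrow> hops u v \<le> k"
  unfolding hops_def using LeastI_ex[OF ex_near[OF assms]] near_mono by (blast intro: Least_le)

text \<open>\<open>distance\<close> is an infimum over walks; with unit costs some walk attains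
  \<open>hops u v\<close>, and no walk is shorter.\<close>

lemma distance_eq_hops:
  assumes uv: "u \<in> pverts G" "v \<in> pverts G"
  shows "distance G u v = ereal (real (hops u v))"
proof -
  have cost: "awalk_cost (\<lambda>_. 1) p = real (length p)" for p
    by (induction p) auto
  obtain p where p: "awalk u p v" "length p \<le> hops u v"
    using near_iff_hops[OF uv, of "hops u v"] near_iff_awalk[OF uv(1)] by auto
  have le: "hops u v \<le> length q" if "awalk u q v" for q
    using near_iff_hops[OF uv, of "length q"] near_iff_awalk[OF uv(1)] that by auto
  show ?thesis
    unfolding distance_def \<mu>_def cost
  proof (rule antisym)
    show "(INF p \<in> {p. awalk u p v}. ereal (real (length p))) \<le> ereal (real (hops u v))"
      using p by (intro INF_lower2[of p]) auto
    show "ereal (real (hops u v)) \<le> (INF p \<in> {p. awalk u p v}. ereal (real (length p)))"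
      using le by (intro INF_greatest) auto
  qed
qed

text \<open>\<open>D - 1\<close> is truncated, so a far pair is demanded for positive
  \<open>D\<close> only; for \<open>D = 0\<close> any vertex paired with itself attains the
  maximum.\<close>

lemma diameter_eqI:
  assumes "\<And>u v. u \<in> pverts G \<Longrightarrow> v \<in> pverts G \<Longrightarrow> near D u v"
    and "0 < D \<Longrightarrow> \<exists>u \<in> pverts G. \<exists>v \<in> pverts G. \<not> near (D - 1) u v"
  shows "diameter G = ereal (real D)"
  unfolding diameter_def
proof (rule Max_eqI)
  have "{distance G u v |u v. u \<in> pverts G \<and> v \<in> pverts G} =
      (\<lambda>(u, v). distance G u v) ` (pverts G \<times> pverts G)" by auto
  then show "finite {distance G u v |u v. u \<in> pverts G \<and> v \<in> pverts G}"
    using pair_finite_verts by simp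
  show "y \<le> ereal (real D)" if "y \<in> {distance G u v |u v. u \<in> pverts G \<and> v \<in> pverts G}" for y
    using that assms(1) near_iff_hops distance_eq_hops by auto
  have "\<exists>u \<in> pverts G. \<exists>v \<in> pverts G. hops u v = D"
  proof (cases "D = 0")
    case True
    obtain u where "u \<in> pverts G" using pverts_nonempty by blast
    then show ?thesis using assms(1)[of u u] near_iff_hops[of u u D] True by auto
  next
    case False
    then obtain u v where uv: "u \<in> pverts G" "v \<in> pverts G" "\<not> near (D - 1) u v" using assms(2) by blast
    then have "hops u v = D" using assms(1)[OF uv(1,2)] near_iff_hops[OF uv(1,2)] False by auto
    then show ?thesis using uv by blast
  qed
  then obtain u v where "u \<in> pverts G" "v \<in> pverts G" "hops u v = D" by blast
  then show "ereal (real D) \<in> {distance G u v |u v. u \<in> pverts G \<and> v \<in> pverts G}"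
    using distance_eq_hops[of u v] by force
qed

end

section \<open>The three classes\<close>

locale min_degree_vertex = connected_pair_graph +
  fixes x
  assumes x_in: "x \<in> pverts G"
    and x_min: "\<And>v. v \<in> pverts G \<Longrightarrow> card (nbrs x) \<le> card (nbrs v)"
begin

text \<open>If \<open>x\<close> sees everything, its degree is the largest possible; being also the
  minimum, it forces the graph to be complete.\<close>

lemma near_1_all:
  assumes "\<And>w. w \<in> pverts G \<Longrightarrow> near 1 x w" "u \<in> pverts G" "v \<in> pverts G"
  shows "near 1 u v"
proof -
  have "pverts G \<subseteq> insert x (nbrs x)" using assms(1) by auto
  then have "card (pverts G) \<le> card (insert x (nbrs x))"
    by (rule card_mono[rotated]) (simp add: finite_nbrs)
  also have "\<dots> \<le> card (insert u (nbrs u))"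
    using x_min[OF assms(2)] finite_nbrs no_loop by simp
  finally have "insert u (nbrs u) = pverts G"
    using nbrs_subset assms(2) pair_finite_verts by (intro card_seteq) auto
  then show ?thesis using assms(3) by auto
qed

end

section \<open>Graphs without P2 + 2P1, the complement of the diamond\<close>

locale co_diamond_free = min_degree_vertex +
  assumes free: "\<And>a b c d. \<lbrakk>(a, b) \<in> parcs G; c \<in> pverts G; d \<in> pverts G; c \<noteq> d;
     (c, d) \<notin> parcs G; c \<notin> {a, b}; d \<notin> {a, b}; (a, c) \<notin> parcs G; (b, c) \<notin> parcs G;
     (a, d) \<notin> parcs G; (b, d) \<notin> parcs G\<rbrakk> \<Longrightarrow> False"
begin

text \<open>Otherwise the edge from \<open>u\<close> to \<open>a\<close> together with
  \<open>r\<close> and \<open>v\<close> induces P2 + 2P1: \<open>v\<close> misses \<open>a\<close>,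
  being more than 2 away from \<open>u\<close>.\<close>

lemma rest_complete:
  assumes "\<not> near 2 u v" "v \<in> pverts G" "r \<in> pverts G"
    "r \<notin> insert u (nbrs u)" "r \<notin> insert v (nbrs v)" "a \<in> nbrs u"
  shows "(r, a) \<in> parcs G"
proof (rule ccontr)
  assume n: "(r, a) \<notin> parcs G"
  note far = far_2[OF assms(1)]
  have *: "(a, r) \<notin> parcs G" "(r, v) \<notin> parcs G" using n assms(5) parcs_sym by auto
  show False
    by (rule free[of u a r v]) (use * n far assms in auto)
qed

text \<open>A vertex outside both closed neighbourhoods sees all of the disjoint nonempty sets
  \<open>nbrs u\<close> and \<open>nbrs v\<close>, so its degree exceeds that of
  \<open>u\<close>.\<close>

lemma minimal_not_rest:
  assumes d: "\<not> near 2 u v" and uv: "u \<in> pverts G" "v \<in> pverts G"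
  shows "x \<in> insert u (nbrs u) \<union> insert v (nbrs v)"
proof (rule ccontr)
  assume x: "\<not> ?thesis"
  have d': "\<not> near 2 v u" using d near_commute by metis
  have "(x, a) \<in> parcs G" if "a \<in> nbrs u" for a
    using rest_complete[OF d uv(2) x_in _ _ that] x by auto
  moreover have "(x, a) \<in> parcs G" if "a \<in> nbrs v" for a
    using rest_complete[OF d' uv(1) x_in _ _ that] x by auto
  ultimately have "nbrs u \<union> nbrs v \<subseteq> nbrs x" by auto
  then have "card (nbrs u \<union> nbrs v) \<le> card (nbrs x)"
    by (rule card_mono[rotated]) (rule finite_nbrs)
  moreover have "card (nbrs u \<union> nbrs v) = card (nbrs u) + card (nbrs v)"
    using far_2[OF d] by (intro card_Un_disjoint finite_nbrs) auto
  moreover have "nbrs v \<noteq> {}" using nbrs_nonempty[of v u] uv far_2[OF d] by auto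
  then have "card (nbrs v) > 0" using finite_nbrs by (simp add: card_gt_0_iff)
  ultimately show False using x_min[OF uv(1)] by linarith
qed

text \<open>Distance above 3 keeps \<open>a\<close> and \<open>a'\<close> away from both ends of an
  edge at \<open>v\<close>; were they not adjacent, they would be the isolated vertices of P2 +
  2P1.\<close>

lemma far_3_clique:
  assumes d: "\<not> near 3 u v" and uv: "u \<in> pverts G" "v \<in> pverts G"
    and a: "a \<in> nbrs u" "a' \<in> nbrs u" "a \<noteq> a'"
  shows "(a, a') \<in> parcs G"
proof (rule ccontr)
  assume n: "(a, a') \<notin> parcs G"
  have d2: "\<not> near 2 u v" using d by (simp add: near_3)
  obtain b where b: "(v, b) \<in> parcs G" using nbrs_nonempty[of v u] uv far_2[OF d2] by auto
  have *: "(b, z) \<notin> parcs G \<and> z \<noteq> b \<and> (v, z) \<notin> parcs G \<and> z \<noteq> v \<and> z \<in> pverts G"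
    if "z \<in> nbrs u" for z
    using that far_3[OF d, of z b] far_2[OF d2] b in_arcsD2[of u z] by auto
  show False
    by (rule free[of v b a a']) (use *[OF a(1)] *[OF a(2)] b a n in auto)
qed

text \<open>No arc joins the two closed neighbourhoods. If they covered the graph, that of
  \<open>u\<close> would be closed under arcs and hence contain \<open>v\<close>.\<close>

lemma far_3_rest:
  assumes d: "\<not> near 3 u v" and uv: "u \<in> pverts G" "v \<in> pverts G"
  obtains r where "r \<in> pverts G" "r \<notin> insert u (nbrs u)" "r \<notin> insert v (nbrs v)"
proof (rule ccontr)
  assume "\<not> thesis"
  then have c: "pverts G \<subseteq> insert u (nbrs u) \<union> insert v (nbrs v)" using that by blast
  have d2: "\<not> near 2 u v" using d by (simp add: near_3)
  have "insert u (nbrs u) = pverts G"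
  proof (rule closed_eq_pverts)
    fix a b assume a: "a \<in> insert u (nbrs u)" and ab: "(a, b) \<in> parcs G"
    have "b \<notin> insert v (nbrs v)"
      using a ab far_3[OF d, of a b] far_2[OF d2] parcs_sym[of a b] by auto
    then show "b \<in> insert u (nbrs u)" using c ab in_arcsD2 by blast
  qed (use uv nbrs_subset in auto)
  with uv(2) have "v \<in> insert u (nbrs u)" by (simp only:)
  then show False using far_2(1,2)[OF d2] by simp
qed

text \<open>As \<open>nbrs u\<close> is a clique, a neighbour \<open>x\<close> of \<open>u\<close>
  of minimum degree has the same closed neighbourhood as \<open>u\<close>. But \<open>x\<close> sees
  the vertex \<open>r\<close> outside both neighbourhoods, and \<open>u\<close> does not.\<close>

lemma far_3_minimal_aux:
  assumes d: "\<not> near 3 u v" and uv: "u \<in> pverts G" "v \<in> pverts G"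
  shows "x \<notin> nbrs u"
proof
  assume x: "x \<in> nbrs u"
  have d2: "\<not> near 2 u v" using d by (simp add: near_3)
  have "insert u (nbrs u) \<subseteq> insert x (nbrs x)"
    using far_3_clique[OF d uv x] x parcs_sym by auto
  note conv = closed_nbrs_converse[OF this x_min[OF uv(1)]]
  obtain r where r: "r \<in> pverts G" "r \<notin> insert u (nbrs u)" "r \<notin> insert v (nbrs v)"
    using far_3_rest[OF d uv] by blast
  then have "(r, x) \<in> parcs G" using rest_complete[OF d2 uv(2) r x] by simp
  then have "(x, r) \<in> parcs G" using parcs_sym by simp
  from conv[OF this] show False using r(2) by simp
qed

lemma far_3_minimal:
  assumes d: "\<not> near 3 u v" and uv: "u \<in> pverts G" "v \<in> pverts G"
  shows "\<exists>w \<in> pverts G. \<not> near 3 x w"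
proof -
  have d2: "\<not> near 2 u v" using d by (simp add: near_3)
  have d': "\<not> near 3 v u" using d near_commute by metis
  have "x \<notin> nbrs u" "x \<notin> nbrs v"
    using far_3_minimal_aux[OF d uv] far_3_minimal_aux[OF d' uv(2,1)] by simp_all
  then have "x = u \<or> x = v" using minimal_not_rest[OF d2 uv] by auto
  then show ?thesis
  proof
    assume "x = u"
    then show ?thesis using d uv(2) by (intro bexI[of _ v]) simp_all
  next
    assume "x = v"
    then show ?thesis using d' uv(1) by (intro bexI[of _ u]) simp_all
  qed
qed

text \<open>For \<open>u\<close> and \<open>v\<close> more than 3 apart, a vertex \<open>r\<close>
  outside both closed neighbourhoods sees all neighbours of either, so \<open>u\<close>,
  \<open>a\<close>, \<open>r\<close>, \<open>b\<close>, \<open>v\<close> is a walk.\<close>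

lemma near_4_all:
  assumes uv: "u \<in> pverts G" "v \<in> pverts G"
  shows "near 4 u v"
proof (cases "near 3 u v")
  case False
  then have d2: "\<not> near 2 u v" by (simp add: near_3)
  then have d2': "\<not> near 2 v u" using near_commute by metis
  obtain r where r: "r \<in> pverts G" "r \<notin> insert u (nbrs u)" "r \<notin> insert v (nbrs v)"
    using far_3_rest[OF False uv] by blast
  obtain a where a: "a \<in> nbrs u" using nbrs_nonempty[of u v] uv far_2[OF d2] by auto
  obtain b where b: "b \<in> nbrs v" using nbrs_nonempty[of v u] uv far_2[OF d2] by auto
  have "(r, a) \<in> parcs G" "(r, b) \<in> parcs G"
    using rest_complete[OF d2 uv(2) r a] rest_complete[OF d2' uv(1) r(1,3,2) b] by auto
  then have "near 2 u r" "near 2 r v" using a b parcs_sym by (auto simp: near_2)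
  from near_trans[OF this] show ?thesis by simp
qed (simp add: near_4)

text \<open>The minimum is strict because the outer neighbours of \<open>v\<close> all lie in the
  clique \<open>?K\<close>, while every other \<open>z\<close> in \<open>?K\<close> sees the rest of
  \<open>?K\<close> and, in addition, a neighbour \<open>p\<close> of \<open>u\<close>.\<close>

lemma far_2_certificate_aux:
  assumes d: "\<not> near 2 u v" and uv: "u \<in> pverts G" "v \<in> pverts G"
    and x2: "near 2 x v" and x: "x \<in> nbrs u"
  shows "certificate x u"
proof -
  let ?K = "pverts G - nbrs x - {x} - nbrs u - {u}"
  have xu: "(x, u) \<in> parcs G" using x parcs_sym by auto
  \<comment> \<open>Two non-adjacent vertices of \<open>?K\<close> would extend the edge from
    \<open>x\<close> to \<open>u\<close> to an induced P2 + 2P1.\<close>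
  have clique: "(y, z) \<in> parcs G" if "y \<in> ?K" "z \<in> ?K" "y \<noteq> z" for y z
    by (rule ccontr, rule free[OF xu, of y z]) (use that parcs_sym in auto)
  have xv: "x \<noteq> v" "(x, v) \<notin> parcs G" using x far_2[OF d] by auto
  have vK: "v \<in> ?K" using xv far_2[OF d] uv by auto
  obtain b where b: "(x, b) \<in> parcs G" "(b, v) \<in> parcs G" using x2 xv unfolding near_2 by auto
  \<comment> \<open>Otherwise \<open>u\<close> and \<open>x\<close> have the same closed
    neighbourhood, and \<open>b\<close> leads from \<open>u\<close> to \<open>v\<close> in at most
    two steps.\<close>
  have "\<not> nbrs u \<subseteq> insert x (nbrs x)"
  proof
    assume "nbrs u \<subseteq> insert x (nbrs x)"
    then have "insert u (nbrs u) \<subseteq> insert x (nbrs x)" using xu by auto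
    from closed_nbrs_converse[OF this x_min[OF uv(1)] b(1)] show False using b far_2[OF d] by auto
  qed
  then obtain p where p: "p \<in> nbrs u" "p \<noteq> x" "p \<notin> nbrs x" by auto
  have "outer_degree x v < outer_degree x z" if z: "z \<in> ?K" "z \<noteq> v" for z
  proof -
    have vz: "(v, z) \<in> parcs G" using clique[OF vK z(1)] z(2) by auto
    \<comment> \<open>If \<open>z\<close> missed \<open>p\<close>, the edge from \<open>v\<close> to
      \<open>z\<close> would induce P2 + 2P1 with \<open>x\<close> and \<open>p\<close>.\<close>
    have zp: "(z, p) \<in> parcs G"
    proof (rule ccontr)
      assume zp: "(z, p) \<notin> parcs G"
      have zx: "(z, x) \<notin> parcs G" "(v, x) \<notin> parcs G" "x \<noteq> z" using z xv parcs_sym by auto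
      have p': "p \<in> pverts G" "(v, p) \<notin> parcs G" "p \<noteq> v" "p \<noteq> z" "(x, p) \<notin> parcs G"
        using p in_arcsD2[of u p] far_2[OF d] z by auto
      show False
        by (rule free[OF vz x_in p'(1)]) (use p' p(2) zx zp xv in simp_all)
    qed
    have sub: "insert p (?K - {z}) \<subseteq> nbrs z - nbrs x - {x}"
    proof
      fix y assume "y \<in> insert p (?K - {z})"
      then consider "y = p" | "y \<in> ?K" "z \<noteq> y" by blast
      then show "y \<in> nbrs z - nbrs x - {x}"
        by cases (use p zp clique[OF z(1), of y] in simp_all)
    qed
    \<comment> \<open>A neighbour of \<open>v\<close> cannot lie in the closed neighbourhood of
      \<open>u\<close>, since \<open>u\<close> is more than 2 away.\<close>
    have "nbrs v - nbrs x - {x} \<subseteq> ?K - {v}"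
      using far_2[OF d] in_arcsD2[of v] no_loop by auto
    then have "outer_degree x v \<le> card (?K - {v})"
      unfolding outer_degree_def by (rule card_mono[rotated]) (simp add: pair_finite_verts)
    also have "\<dots> = card (?K - {z})" using vK z pair_finite_verts by (simp only: card_Diff_singleton)
    \<comment> \<open>Strict, because \<open>p\<close> is a neighbour of \<open>u\<close> and hence
      outside \<open>?K\<close>.\<close>
    also have "\<dots> < card (insert p (?K - {z}))" using p pair_finite_verts by simp
    also have "\<dots> \<le> outer_degree x z"
      unfolding outer_degree_def by (intro card_mono sub finite_Diff finite_nbrs)
    finally show ?thesis .
  qed
  then show ?thesis unfolding certificate_def using vK d by blast
qed

text \<open>\<open>x\<close> reaches everything within two steps, so it is neither \<open>u\<close>
  nor \<open>v\<close>; by \<open>minimal_not_rest\<close> it is adjacent to one of them.\<close>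

lemma far_2_certificate:
  assumes d: "\<not> near 2 u v" and uv: "u \<in> pverts G" "v \<in> pverts G"
    and x2: "\<And>w. w \<in> pverts G \<Longrightarrow> near 2 x w"
  shows "\<exists>u \<in> nbrs x. certificate x u"
proof -
  have d': "\<not> near 2 v u" using d near_commute by metis
  have "x \<noteq> u" "x \<noteq> v" using x2 uv d d' by auto
  then consider "x \<in> nbrs u" | "x \<in> nbrs v" using minimal_not_rest[OF d uv] by auto
  then show ?thesis
  proof cases
    case 1
    then show ?thesis
      using far_2_certificate_aux[OF d uv x2[OF uv(2)]] parcs_sym by blast
  next
    case 2
    then show ?thesis
      using far_2_certificate_aux[OF d' uv(2,1) x2[OF uv(1)]] parcs_sym by blast
  qed
qed

end

section \<open>Graphs without P3 + P1, the complement of the paw\<close>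

locale co_paw_free = min_degree_vertex +
  assumes free: "\<And>a b c d. \<lbrakk>(a, b) \<in> parcs G; (b, c) \<in> parcs G; a \<noteq> c; (a, c) \<notin> parcs G;
     d \<in> pverts G; d \<notin> {a, b, c}; (a, d) \<notin> parcs G; (b, d) \<notin> parcs G; (c, d) \<notin> parcs G\<rbrakk> \<Longrightarrow> False"
begin

text \<open>Two non-adjacent neighbours of \<open>u\<close> form an induced P3 with \<open>u\<close>
  in the middle, and \<open>v\<close> sees none of the three.\<close>

lemma clique_nbrs:
  assumes d: "\<not> near 2 u v" and uv: "u \<in> pverts G" "v \<in> pverts G"
    and a: "a \<in> nbrs u" "a' \<in> nbrs u" "a \<noteq> a'"
  shows "(a, a') \<in> parcs G"
proof (rule ccontr)
  assume n: "(a, a') \<notin> parcs G"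
  have "(a, u) \<in> parcs G" using a parcs_sym by simp
  then show False
    by (rule free[of a u a' v]) (use n a uv far_2[OF d] in auto)
qed

text \<open>An arc leaving the union yields an induced path \<open>p\<close>, \<open>a\<close>,
  \<open>b\<close> of which \<open>q\<close> sees no vertex. So the union is closed under
  arcs.\<close>

lemma covers:
  assumes d: "\<not> near 2 u v" and uv: "u \<in> pverts G" "v \<in> pverts G"
  shows "pverts G = insert u (nbrs u) \<union> insert v (nbrs v)"
proof -
  have d': "\<not> near 2 v u" using d near_commute by metis
  have aux: "b \<in> insert p (nbrs p) \<union> insert q (nbrs q)"
    if "(a, b) \<in> parcs G" "a \<in> insert p (nbrs p)" "\<not> near 2 p q" "q \<in> pverts G" for a b p q
  proof (rule ccontr)
    assume n: "\<not> ?thesis"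
    then have *: "(p, a) \<in> parcs G" "(b, q) \<notin> parcs G" using that(1,2) parcs_sym by auto
    show False
      by (rule free[of p a b q]) (use * n that far_2[OF that(3)] in auto)
  qed
  have "insert u (nbrs u) \<union> insert v (nbrs v) = pverts G"
  proof (rule closed_eq_pverts)
    fix a b assume "a \<in> insert u (nbrs u) \<union> insert v (nbrs v)" "(a, b) \<in> parcs G"
    then show "b \<in> insert u (nbrs u) \<union> insert v (nbrs v)"
      using aux[of a b u v] aux[of a b v u] d d' uv by blast
  qed (use uv nbrs_subset in auto)
  then show ?thesis by simp
qed

text \<open>The two closed neighbourhoods would cover the graph with no arc between them,
  contradicting connectivity.\<close>

lemma near_3_all:
  assumes uv: "u \<in> pverts G" "v \<in> pverts G"
  shows "near 3 u v"
proof (rule ccontr)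
  assume d3: "\<not> ?thesis"
  then have d: "\<not> near 2 u v" by (simp add: near_3)
  have "insert u (nbrs u) = pverts G"
  proof (rule closed_eq_pverts)
    fix a b assume a: "a \<in> insert u (nbrs u)" and ab: "(a, b) \<in> parcs G"
    have "b \<notin> insert v (nbrs v)"
      using a ab far_3[OF d3, of a b] far_2[OF d] parcs_sym[of a b] by auto
    then show "b \<in> insert u (nbrs u)" using ab in_arcsD2 covers[OF d uv] by blast
  qed (use uv nbrs_subset in auto)
  with uv(2) have "v \<in> insert u (nbrs u)" by (simp only:)
  then show False using far_2(1,2)[OF d] by simp
qed

text \<open>The closed neighbourhood of \<open>u\<close> is a clique, so by minimality of its degree
  \<open>x\<close> has the same one; a walk of at most two steps from \<open>x\<close> to
  \<open>v\<close> would give one from \<open>u\<close>.\<close>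

lemma far_2_minimal_aux:
  assumes d: "\<not> near 2 u v" and uv: "u \<in> pverts G" "v \<in> pverts G" and x: "x \<in> insert u (nbrs u)"
  shows "\<not> near 2 x v"
proof -
  have "insert u (nbrs u) \<subseteq> insert x (nbrs x)"
    using clique_nbrs[OF d uv, of x] x parcs_sym by auto
  note conv = closed_nbrs_converse[OF this x_min[OF uv(1)]]
  show ?thesis
  proof
    assume "near 2 x v"
    then consider "x = v" | "(x, v) \<in> parcs G" | z where "(x, z) \<in> parcs G" "(z, v) \<in> parcs G"
      unfolding near_2 by blast
    then show False
    proof cases
      case 1
      then show ?thesis using x far_2[OF d] by simp
    next
      case 2
      then show ?thesis using conv[OF 2] far_2[OF d] by simp
    next
      case 3
      then show ?thesis using conv[OF 3(1)] far_2[OF d] by auto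
    qed
  qed
qed

lemma far_2_minimal:
  assumes d: "\<not> near 2 u v" and uv: "u \<in> pverts G" "v \<in> pverts G"
  shows "\<exists>w \<in> pverts G. \<not> near 2 x w"
proof -
  have d': "\<not> near 2 v u" using d near_commute by metis
  have "x \<in> insert u (nbrs u) \<or> x \<in> insert v (nbrs v)" using covers[OF d uv] x_in by blast
  then show ?thesis
    using far_2_minimal_aux[OF d uv] far_2_minimal_aux[OF d' uv(2,1)] uv by blast
qed

end

section \<open>Graphs without P4\<close>

lemma (in connected_pair_graph) cograph_near_2:
  assumes free: "\<And>a b c d. \<lbrakk>(a, b) \<in> parcs G; (b, c) \<in> parcs G; (c, d) \<in> parcs G;
     distinct [a, b, c, d]; (a, c) \<notin> parcs G; (a, d) \<notin> parcs G; (b, d) \<notin> parcs G\<rbrakk> \<Longrightarrow> False"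
    and uv: "u \<in> pverts G" "v \<in> pverts G"
  shows "near 2 u v"
proof -
  have "{v \<in> pverts G. near 2 u v} = pverts G"
  proof (rule closed_eq_pverts)
    show "{v \<in> pverts G. near 2 u v} \<noteq> {}" using uv(1) by (auto simp: near_2)
    fix b c assume b: "b \<in> {v \<in> pverts G. near 2 u v}" and bc: "(b, c) \<in> parcs G"
    \<comment> \<open>Otherwise a two-step walk \<open>u\<close>, \<open>a\<close>, \<open>b\<close>
      extends by \<open>c\<close> to an induced path on four vertices.\<close>
    have "near 2 u c"
    proof (rule ccontr)
      assume d: "\<not> near 2 u c"
      then obtain a where a: "(u, a) \<in> parcs G" "(a, b) \<in> parcs G"
        using b bc unfolding near_2 by blast
      have *: "u \<noteq> b" "(u, b) \<notin> parcs G" "(a, c) \<notin> parcs G" using a bc far_2[OF d] by auto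
      have "distinct [u, a, b, c]" using a bc * far_2(1,2)[OF d] no_loop by auto
      then show False
        using free[OF a bc _ *(2) far_2(2)[OF d] *(3)] by simp
    qed
    then show "c \<in> {v \<in> pverts G. near 2 u v}" using bc in_arcsD2 by blast
  qed auto
  then show ?thesis using uv(2) by blast
qed

section \<open>Induced subgraphs\<close>

text \<open>\<open>induced_in\<close> reduced to its vertex map: this form composes, and it can be
  checked arc by arc on concrete graphs.\<close>

definition embeds :: "('a \<Rightarrow> 'b) \<Rightarrow> 'a pair_pre_digraph \<Rightarrow> 'b pair_pre_digraph \<Rightarrow> bool" where
  "embeds f H G \<longleftrightarrow> inj_on f (pverts H) \<and> f ` pverts H \<subseteq> pverts G \<and>
     (\<forall>u \<in> pverts H. \<forall>v \<in> pverts H. (u, v) \<in> parcs H \<longleftrightarrow> (f u, f v) \<in> parcs G)"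

lemma embeds_comp: "embeds f H K \<Longrightarrow> embeds g K G \<Longrightarrow> embeds (g \<circ> f) H G"
  unfolding embeds_def by (auto simp: image_subset_iff intro: comp_inj_on inj_on_subset)

lemma induced_in_imp_embeds:
  assumes "induced_in H G"
  shows "\<exists>f. embeds f H G"
proof -
  obtain H' h where ind: "induced_subgraph H' (with_proj G)"
    and iso: "pre_digraph.digraph_isomorphism (with_proj H) h" and H': "H' = app_iso h (with_proj H)"
    using assms unfolding induced_in_def digraph_iso_def by blast
  let ?f = "iso_verts h"
  \<comment> \<open>An induced subgraph shares the tail and head maps of \<open>with_proj G\<close>,
    so the vertex map determines the image of every arc.\<close>
  have tail: "iso_tail h = fst" and head: "iso_head h = snd"
    using ind unfolding induced_subgraph_def subgraph_def compatible_def H' by auto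
  have inj: "inj_on ?f (pverts H)" and inja: "inj_on (iso_arcs h) (parcs H)"
    and wf: "wf_digraph (with_proj H)"
    and arcs: "\<And>a. a \<in> parcs H \<Longrightarrow> ?f (fst a) = fst (iso_arcs h a) \<and> ?f (snd a) = snd (iso_arcs h a)"
    using iso unfolding pre_digraph.digraph_isomorphism_def by (auto simp: tail head)
  have arc_eq: "iso_arcs h (u, v) = (?f u, ?f v)" if "(u, v) \<in> parcs H" for u v
    using arcs[OF that] by (simp add: prod_eq_iff)
  have img: "iso_arcs h ` parcs H = {e \<in> parcs G. fst e \<in> ?f ` pverts H \<and> snd e \<in> ?f ` pverts H}"
    and sub: "?f ` pverts H \<subseteq> pverts G"
    using ind unfolding induced_subgraph_def subgraph_def H' by auto
  have "(u, v) \<in> parcs H \<longleftrightarrow> (?f u, ?f v) \<in> parcs G" if uv: "u \<in> pverts H" "v \<in> pverts H" for u v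
  proof
    assume a: "(u, v) \<in> parcs H"
    then have "iso_arcs h (u, v) \<in> iso_arcs h ` parcs H" by (rule imageI)
    then show "(?f u, ?f v) \<in> parcs G" unfolding img arc_eq[OF a] by simp
  next
    assume "(?f u, ?f v) \<in> parcs G"
    then have "(?f u, ?f v) \<in> iso_arcs h ` parcs H" using uv by (simp add: img)
    then obtain a b where ab: "(a, b) \<in> parcs H" "(?f u, ?f v) = iso_arcs h (a, b)" by auto
    then have "?f u = ?f a" "?f v = ?f b" using arc_eq[OF ab(1)] by auto
    moreover have "a \<in> pverts H" "b \<in> pverts H"
      using wf_digraph.wellformed[OF wf, of "(a, b)"] ab(1) by auto
    ultimately show "(u, v) \<in> parcs H" using inj_onD[OF inj] uv ab(1) by metis
  qed
  then show ?thesis unfolding embeds_def using inj sub by blast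
qed

lemma embeds_imp_induced_in:
  assumes wfH: "pair_wf_digraph H" and wfG: "pair_wf_digraph G" and f: "embeds f H G"
  shows "induced_in H G"
proof -
  interpret H: pair_wf_digraph H by (rule wfH)
  interpret G: pair_wf_digraph G by (rule wfG)
  let ?h = "\<lparr>iso_verts = f, iso_arcs = map_prod f f, iso_head = snd, iso_tail = fst\<rparr>"
  have inj: "inj_on f (pverts H)" and sub: "f ` pverts H \<subseteq> pverts G"
    and arc: "\<And>u v. u \<in> pverts H \<Longrightarrow> v \<in> pverts H \<Longrightarrow> (u, v) \<in> parcs H \<longleftrightarrow> (f u, f v) \<in> parcs G"
    using f unfolding embeds_def by auto
  have "inj_on (map_prod f f) (parcs H)"
    by (rule inj_on_subset[OF map_prod_inj_on[OF inj inj]]) (auto dest: H.wellformed')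
  then have iso: "pre_digraph.digraph_isomorphism (with_proj H) ?h"
    unfolding pre_digraph.digraph_isomorphism_def using inj H.wf_digraph_axioms by auto
  have arcs_in: "map_prod f f ` parcs H = {e \<in> parcs G. fst e \<in> f ` pverts H \<and> snd e \<in> f ` pverts H}"
  proof (intro equalityI subsetI)
    fix e assume "e \<in> map_prod f f ` parcs H"
    then obtain u v where "(u, v) \<in> parcs H" "e = (f u, f v)" by auto
    then show "e \<in> {e \<in> parcs G. fst e \<in> f ` pverts H \<and> snd e \<in> f ` pverts H}"
      using arc[of u v] H.wellformed' by auto
  next
    fix e assume "e \<in> {e \<in> parcs G. fst e \<in> f ` pverts H \<and> snd e \<in> f ` pverts H}"
    then obtain u v where "u \<in> pverts H" "v \<in> pverts H" "e = (f u, f v)" "e \<in> parcs G"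
      by (cases e) auto
    then have "e = map_prod f f (u, v)" "(u, v) \<in> parcs H" using arc[of u v] by simp_all
    then show "e \<in> map_prod f f ` parcs H" by (rule image_eqI)
  qed
  have "wf_digraph (app_iso ?h (with_proj H))" by (rule H.wf_digraphI_app_iso[OF iso])
  then have "induced_subgraph (app_iso ?h (with_proj H)) (with_proj G)"
    unfolding induced_subgraph_def subgraph_def compatible_def
    using G.wf_digraph_axioms sub arcs_in by auto
  then show ?thesis unfolding induced_in_def digraph_iso_def using iso by blast
qed

text \<open>Composing embeddings of \<open>H\<close> in \<open>K\<close> and of \<open>K\<close> in
  \<open>G\<close> would place \<open>H\<close> in \<open>G\<close>. Thus only the three maximal
  choices of \<open>K\<close> have to be studied.\<close>

lemma induced_free_no_embedding:
  assumes "pair_wf_digraph H" "pair_wf_digraph G" "induced_in H K" "induced_free H G"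
  shows "\<not> embeds g K G"
  using assms induced_in_imp_embeds embeds_comp embeds_imp_induced_in unfolding induced_free_def by metis

lemma (in pair_graph) embeds_co_diamond:
  assumes "(a, b) \<in> parcs G" "c \<in> pverts G" "d \<in> pverts G" "c \<noteq> d" "(c, d) \<notin> parcs G"
    "c \<notin> {a, b}" "d \<notin> {a, b}" "(a, c) \<notin> parcs G" "(b, c) \<notin> parcs G"
    "(a, d) \<notin> parcs G" "(b, d) \<notin> parcs G"
  shows "embeds (case_sum (\<lambda>i. if i = 0 then a else b) (\<lambda>(i, _). if i = 0 then c else d))
    (disj_union (path_graph 2) (copies 2 (path_graph 1))) G"
proof -
  have V: "{..<2::nat} = {0, 1}" "{..<1::nat} = {0}" by auto
  have *: "(b, a) \<in> parcs G" "(c, a) \<notin> parcs G" "(d, a) \<notin> parcs G" "(c, b) \<notin> parcs G"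
    "(d, b) \<notin> parcs G" "(d, c) \<notin> parcs G"
    using assms parcs_sym by auto
  show ?thesis
    unfolding embeds_def disj_union_def copies_def path_graph_def
    using assms * no_loop in_arcsD1[OF assms(1)] in_arcsD2[OF assms(1)]
    by (auto simp: V inj_on_def image_iff Plus_def)
qed

lemma (in pair_graph) embeds_co_paw:
  assumes "(a, b) \<in> parcs G" "(b, c) \<in> parcs G" "a \<noteq> c" "(a, c) \<notin> parcs G"
     "d \<in> pverts G" "d \<notin> {a, b, c}" "(a, d) \<notin> parcs G" "(b, d) \<notin> parcs G" "(c, d) \<notin> parcs G"
  shows "embeds (case_sum (\<lambda>i. if i = 0 then a else if i = 1 then b else c) (\<lambda>_. d))
    (disj_union (path_graph 3) (path_graph 1)) G"
proof -
  have V: "{..<3::nat} = {0, 1, 2}" "{..<1::nat} = {0}" by auto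
  have *: "(b, a) \<in> parcs G" "(c, b) \<in> parcs G" "(c, a) \<notin> parcs G" "(d, a) \<notin> parcs G"
    "(d, b) \<notin> parcs G" "(d, c) \<notin> parcs G"
    using assms parcs_sym by auto
  have "a \<noteq> b" "b \<noteq> c" using assms no_loop by auto
  then show ?thesis
    unfolding embeds_def disj_union_def path_graph_def
    using assms * no_loop in_arcsD1[OF assms(1)] in_arcsD2[OF assms(1)] in_arcsD2[OF assms(2)]
    by (auto simp: V inj_on_def image_iff Plus_def)
qed

lemma (in pair_graph) embeds_path_4:
  assumes "(a, b) \<in> parcs G" "(b, c) \<in> parcs G" "(c, d) \<in> parcs G"
     "distinct [a, b, c, d]" "(a, c) \<notin> parcs G" "(a, d) \<notin> parcs G" "(b, d) \<notin> parcs G"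
  shows "embeds (\<lambda>i. if i = 0 then a else if i = 1 then b else if i = 2 then c else d) (path_graph 4) G"
proof -
  have V: "{..<4::nat} = {0, 1, 2, 3}" by auto
  have *: "(b, a) \<in> parcs G" "(c, b) \<in> parcs G" "(d, c) \<in> parcs G" "(c, a) \<notin> parcs G"
    "(d, a) \<notin> parcs G" "(d, b) \<notin> parcs G"
    using assms parcs_sym by auto
  then show ?thesis
    unfolding embeds_def path_graph_def
    using assms * no_loop in_arcsD1[OF assms(1)] in_arcsD2[OF assms(1)] in_arcsD1[OF assms(3)]
      in_arcsD2[OF assms(3)]
    by (auto simp: V inj_on_def)
qed

section \<open>Reasoning about RAM programs\<close>

definition runs :: "nat \<Rightarrow> com \<Rightarrow> ram_state \<Rightarrow> nat \<Rightarrow> (ram_state \<Rightarrow> bool) \<Rightarrow> bool" where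
  "runs W c s T Q \<longleftrightarrow> (\<exists>t s'. exec W c s t s' \<and> t \<le> T \<and> Q s')"

lemma runs_mono:
  "runs W c s T Q \<Longrightarrow> T \<le> T' \<Longrightarrow> (\<And>s'. Q s' \<Longrightarrow> Q' s') \<Longrightarrow> runs W c s T' Q'"
  unfolding runs_def by (meson le_trans)

lemma runs_Seq:
  assumes "runs W c1 s T1 P" "\<And>s'. P s' \<Longrightarrow> runs W c2 s' T2 Q" "T1 + T2 \<le> T"
  shows "runs W (Seq c1 c2) s T Q"
proof -
  obtain t1 s1 where 1: "exec W c1 s t1 s1" "t1 \<le> T1" "P s1" using assms(1) by (auto simp: runs_def)
  obtain t2 s2 where 2: "exec W c2 s1 t2 s2" "t2 \<le> T2" "Q s2" using assms(2)[OF 1(3)] by (auto simp: runs_def)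
  have "exec W (Seq c1 c2) s (t1 + t2) s2" using 1 2 by (intro exec.Seq)
  then show ?thesis using 1 2 assms(3) unfolding runs_def
    by (intro exI[of _ "t1 + t2"] exI[of _ s2]) simp
qed

text \<open>Loop-free code gets a functional semantics, so that a pass through a loop body is
  computed by rewriting.\<close>

fun eval_com :: "com \<Rightarrow> ram_state \<Rightarrow> ram_state" where
  "eval_com Skip s = s"
| "eval_com (Const x k) s = set_reg x k s"
| "eval_com (Move x y) s = set_reg x (reg s y) s"
| "eval_com (Add x y z) s = set_reg x (reg s y + reg s z) s"
| "eval_com (Sub x y z) s = set_reg x (reg s y - reg s z) s"
| "eval_com (Load x a i) s = set_reg x (arr s a (reg s i)) s"
| "eval_com (Store a i x) s = set_arr a (reg s i) (reg s x) s"
| "eval_com (Seq c1 c2) s = eval_com c2 (eval_com c1 s)"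
| "eval_com (If b c1 c2) s = (if holds b s then eval_com c1 s else eval_com c2 s)"
| "eval_com (While b c) s = s"

text \<open>Loops count as unsafe, so \<^const>\<open>eval_com\<close> is only used on loop-free programs.\<close>

fun safe :: "nat \<Rightarrow> com \<Rightarrow> ram_state \<Rightarrow> bool" where
  "safe W (Const x k) s \<longleftrightarrow> k \<le> W"
| "safe W (Add x y z) s \<longleftrightarrow> reg s y + reg s z \<le> W"
| "safe W (Seq c1 c2) s \<longleftrightarrow> safe W c1 s \<and> safe W c2 (eval_com c1 s)"
| "safe W (If b c1 c2) s \<longleftrightarrow> (if holds b s then safe W c1 s else safe W c2 s)"
| "safe W (While b c) s \<longleftrightarrow> False"
| "safe W c s \<longleftrightarrow> True"

text \<open>The value at a loop is a mere default: \<open>cost\<close> bounds a running time only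
  together with \<open>safe\<close>, which excludes loops.\<close>

fun cost :: "com \<Rightarrow> nat" where
  "cost (Seq c1 c2) = cost c1 + cost c2"
| "cost (If b c1 c2) = 1 + max (cost c1) (cost c2)"
| "cost c = 1"

lemma exec_eval_com: "safe W c s \<Longrightarrow> \<exists>t \<le> cost c. exec W c s t (eval_com c s)"
proof (induction c arbitrary: s)
  case (Seq c1 c2)
  then obtain t1 t2 where "t1 \<le> cost c1" "exec W c1 s t1 (eval_com c1 s)"
    "t2 \<le> cost c2" "exec W c2 (eval_com c1 s) t2 (eval_com c2 (eval_com c1 s))"
    by fastforce
  then show ?case by (intro exI[of _ "t1 + t2"]) (auto intro: exec.Seq)
next
  case (If b c1 c2)
  show ?case
  proof (cases "holds b s")
    case True
    then obtain t where "t \<le> cost c1" "exec W c1 s t (eval_com c1 s)" using If by fastforce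
    then show ?thesis using True by (intro exI[of _ "1 + t"]) (use exec.IfTrue in fastforce)
  next
    case False
    then obtain t where "t \<le> cost c2" "exec W c2 s t (eval_com c2 s)" using If by fastforce
    then show ?thesis using False by (intro exI[of _ "1 + t"]) (use exec.IfFalse in fastforce)
  qed
qed (auto intro!: exI[of _ "Suc 0"] intro: exec.intros[unfolded One_nat_def])

lemma runs_straight:
  assumes "safe W c s" "Q (eval_com c s)" "cost c \<le> T"
  shows "runs W c s T Q"
  using exec_eval_com[OF assms(1)] assms(2,3) unfolding runs_def by (meson le_trans)

fun written_regs :: "com \<Rightarrow> nat set" where
  "written_regs (Const x k) = {x}"
| "written_regs (Move x y) = {x}"
| "written_regs (Add x y z) = {x}"
| "written_regs (Sub x y z) = {x}"
| "written_regs (Load x a i) = {x}"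
| "written_regs (Seq c1 c2) = written_regs c1 \<union> written_regs c2"
| "written_regs (If b c1 c2) = written_regs c1 \<union> written_regs c2"
| "written_regs (While b c) = written_regs c"
| "written_regs c = {}"

fun written_arrs :: "com \<Rightarrow> nat set" where
  "written_arrs (Store a i x) = {a}"
| "written_arrs (Seq c1 c2) = written_arrs c1 \<union> written_arrs c2"
| "written_arrs (If b c1 c2) = written_arrs c1 \<union> written_arrs c2"
| "written_arrs (While b c) = written_arrs c"
| "written_arrs c = {}"

text \<open>A syntactic frame condition; with it, loop invariants mention only the memory that
  changes.\<close>

definition frame :: "com \<Rightarrow> ram_state \<Rightarrow> ram_state \<Rightarrow> bool" where
  "frame c s s' \<longleftrightarrow> (\<forall>r. r \<notin> written_regs c \<longrightarrow> reg s' r = reg s r) \<and>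
     (\<forall>a. a \<notin> written_arrs c \<longrightarrow> arr s' a = arr s a)"

lemma frame_refl: "frame c s s"
  by (simp add: frame_def)

lemma frame_trans: "frame c s s' \<Longrightarrow> frame c s' s'' \<Longrightarrow> frame c s s''"
  by (simp add: frame_def)

lemma exec_frame: "exec W c s t s' \<Longrightarrow> frame c s s'"
  by (induction rule: exec.induct) (auto simp: frame_def set_reg_def set_arr_def)

lemma runs_frame: "runs W c s T Q \<Longrightarrow> runs W c s T (\<lambda>s'. Q s' \<and> frame c s s')"
  unfolding runs_def using exec_frame by blast

lemma runs_While_aux:
  fixes \<mu> :: "ram_state \<Rightarrow> nat"
  assumes step: "\<And>s'. I s' \<Longrightarrow> frame c s0 s' \<Longrightarrow> holds b s' \<Longrightarrow>
      runs W c s' K (\<lambda>s''. I s'' \<and> \<mu> s'' < \<mu> s')"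
    and "I s" "frame c s0 s"
  shows "runs W (While b c) s (1 + (K + 1) * \<mu> s) (\<lambda>s'. I s' \<and> frame c s0 s' \<and> \<not> holds b s')"
  using assms(2,3)
proof (induction "\<mu> s" arbitrary: s rule: less_induct)
  case less
  show ?case
  proof (cases "holds b s")
    case True
    obtain t1 s1 where 1: "exec W c s t1 s1" "t1 \<le> K" "I s1" "\<mu> s1 < \<mu> s"
      using step[OF less.prems True] unfolding runs_def by blast
    have "frame c s0 s1" using frame_trans[OF less.prems(2) exec_frame[OF 1(1)]] .
    then obtain t2 s2 where 2: "exec W (While b c) s1 t2 s2" "t2 \<le> 1 + (K + 1) * \<mu> s1"
      "I s2" "frame c s0 s2" "\<not> holds b s2"
      using less.hyps[OF 1(4,3)] unfolding runs_def by blast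
    have "1 + t1 + t2 \<le> 1 + K + (1 + (K + 1) * \<mu> s1)" using 1(2) 2(2) by simp
    also have "\<dots> = 1 + (K + 1) * (\<mu> s1 + 1)" by simp
    also have "\<dots> \<le> 1 + (K + 1) * \<mu> s" using 1(4) by (intro add_left_mono mult_le_mono2) simp
    finally show ?thesis
      unfolding runs_def using exec.WhileTrue[OF True 1(1) 2(1)] 2(3-5) by blast
  next
    case False
    then show ?thesis unfolding runs_def using exec.WhileFalse[OF False] less.prems
      by (intro exI[of _ 1] exI[of _ s]) simp
  qed
qed

text \<open>At most \<open>N\<close> rounds of \<open>K\<close> steps and one test each, plus the
  final failing test. The frame fact refers to the state before the loop and comes for free.\<close>

lemma runs_While:
  fixes \<mu> :: "ram_state \<Rightarrow> nat"
  assumes "I s" "\<mu> s \<le> N" "1 + (K + 1) * N \<le> T"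
    and "\<And>s'. I s' \<Longrightarrow> frame c s s' \<Longrightarrow> holds b s' \<Longrightarrow> runs W c s' K (\<lambda>s''. I s'' \<and> \<mu> s'' < \<mu> s')"
    and "\<And>s'. I s' \<Longrightarrow> frame c s s' \<Longrightarrow> \<not> holds b s' \<Longrightarrow> Q s'"
  shows "runs W (While b c) s T Q"
proof (rule runs_mono[OF runs_While_aux[OF assms(4,1) frame_refl]])
  have "1 + (K + 1) * \<mu> s \<le> 1 + (K + 1) * N" using assms(2) by (intro add_left_mono mult_le_mono2)
  then show "1 + (K + 1) * \<mu> s \<le> T" using assms(3) by linarith
qed (use assms(5) in auto)

lemma runs_While_straight:
  fixes \<mu> :: "ram_state \<Rightarrow> nat"
  assumes "I s" "\<mu> s \<le> N" "1 + (cost c + 1) * N \<le> T"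
    and "\<And>s'. I s' \<Longrightarrow> frame c s s' \<Longrightarrow> holds b s' \<Longrightarrow>
      safe W c s' \<and> I (eval_com c s') \<and> \<mu> (eval_com c s') < \<mu> s'"
    and "\<And>s'. I s' \<Longrightarrow> frame c s s' \<Longrightarrow> \<not> holds b s' \<Longrightarrow> Q s'"
  shows "runs W (While b c) s T Q"
proof (rule runs_While[where I = I and \<mu> = \<mu> and K = "cost c", OF assms(1-3) _ assms(5)])
  fix s' assume "I s'" "frame c s s'" "holds b s'"
  from assms(4)[OF this] show "runs W c s' (cost c) (\<lambda>s''. I s'' \<and> \<mu> s'' < \<mu> s')"
    by (intro runs_straight) auto
qed

lemma set_reg_simps [simp]:
  "reg (set_reg x k s) = (reg s)(x := k)" "arr (set_reg x k s) = arr s"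
  "reg (set_arr a i k s) = reg s" "arr (set_arr a i k s) = (arr s)(a := (arr s a)(i := k))"
  by (simp_all add: set_reg_def set_arr_def)

lemma runs_Seq_straight:
  assumes "safe W c1 s" "cost c1 \<le> T" "runs W c2 (eval_com c1 s) (T - cost c1) Q"
  shows "runs W (Seq c1 c2) s T Q"
  by (rule runs_Seq[OF runs_straight[OF assms(1) _ order.refl, where Q = "\<lambda>s'. s' = eval_com c1 s"]])
    (use assms in auto)

fun block :: "com list \<Rightarrow> com" where
  "block [] = Skip"
| "block [c] = c"
| "block (c # d # cs) = Seq c (block (d # cs))"

section \<open>The program\<close>

text \<open>
  Register 0 holds the number of vertices, 1 the constant one, 2 the number of arcs, 8 a vertex
  \<open>x\<close> of minimum degree, 10 the current value of 4 minus the answer, and 11 the constant three.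
  Array 2 holds the tails of the arcs (whose heads are in array 1), array 3 the distances to \<open>x\<close> in
  the encoding 4 minus distance, and array 4 the number of neighbours outside the closed
  neighbourhood of \<open>x\<close>. Array 5 marks the closed neighbourhood of a vertex \<open>u\<close>; every \<open>u\<close> gets a
  fresh stamp (register 14), so that the marks need not be erased.
\<close>

definition src_loop :: com where
  "src_loop = block [Add 5 4 1, Load 6 0 5,
     If (Less 3 6) (block [Store 2 3 4, Add 3 3 1]) (Move 4 5)]"

definition src_prog :: com where
  "src_prog = block [Const 3 0, Const 4 0, While (Less 3 2) src_loop]"

definition min_loop :: com where
  "min_loop = block [Add 5 3 1, Load 6 0 5, Load 9 0 3, Sub 6 6 9,
     If (Less 6 7) (block [Move 7 6, Move 8 3]) Skip, Move 3 5]"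

definition min_prog :: com where
  "min_prog = block [Const 3 0, Move 7 0, Const 8 0, While (Less 3 0) min_loop]"

text \<open>The body of a Bellman-Ford pass; in the encoding 4 minus distance, larger means
  nearer.\<close>

definition relax_loop :: com where
  "relax_loop = block [Load 5 2 3, Load 6 1 3, Load 5 3 5, Sub 5 5 1, Load 9 3 6,
     If (Less 9 5) (Store 3 6 5) Skip, Add 3 3 1]"

definition relax_prog :: com where
  "relax_prog = block [Const 3 0, While (Less 3 2) relax_loop]"

definition ecc_loop :: com where
  "ecc_loop = block [Load 5 3 3, If (Less 5 10) (Move 10 5) Skip, Add 3 3 1]"

definition ecc_prog :: com where
  "ecc_prog = block [Const 3 0, Const 10 4, While (Less 3 0) ecc_loop]"

definition outer_loop :: com where
  "outer_loop = block [Load 5 2 3, Load 6 1 3, Load 6 3 6,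
     If (Less 6 11) (block [Load 6 4 5, Add 6 6 1, Store 4 5 6]) Skip, Add 3 3 1]"

definition outer_prog :: com where
  "outer_prog = block [Const 11 3, Const 3 0, While (Less 3 2) outer_loop]"

definition mark_loop :: com where
  "mark_loop = block [Load 5 1 15, Store 5 5 14, Add 15 15 1]"

definition mark_prog :: com where
  "mark_prog = block [Store 5 13 14, Load 15 0 13, Add 5 13 1, Load 16 0 5,
     While (Less 15 16) mark_loop]"

definition pick_loop :: com where
  "pick_loop = block [Load 5 3 15,
     If (Less 5 11)
       (block [Load 5 5 15,
          If (Eq 5 14) Skip
            (block [Load 5 4 15, If (Less 5 18) (block [Move 18 5, Move 17 15]) Skip])])
       Skip,
     Add 15 15 1]"

definition pick_prog :: com where
  "pick_prog = block [Move 17 13, Move 18 0, Const 15 0, While (Less 15 0) pick_loop]"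

definition test_loop :: com where
  "test_loop = block [Load 5 1 15, Load 5 5 5, If (Eq 5 14) (Const 19 0) Skip, Add 15 15 1]"

text \<open>Scanning the neighbours of the candidate suffices: an unmarked vertex without marked
  neighbours is more than 2 away from \<open>u\<close>.\<close>

definition test_prog :: com where
  "test_prog = block [Const 19 1, Load 15 0 17, Add 5 17 1, Load 16 0 5,
     While (Less 15 16) test_loop]"

text \<open>The stamp is one more than the address of \<open>u\<close> in the arc array: nonzero,
  and larger than all earlier stamps. A passed test changes register 10 only from a larger value to
  1, the code of diameter 3.\<close>

definition cert_loop :: com where
  "cert_loop = block [Load 13 1 3, Add 14 3 1, mark_prog, pick_prog, test_prog,
     If (Less 19 1) Skip (If (Less 1 10) (Move 10 1) Skip), Add 3 3 1]"

definition cert_prog :: com where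
  "cert_prog = block [Load 3 0 8, Add 5 8 1, Load 12 0 5, While (Less 3 12) cert_loop]"

definition diameter_prog :: com where
  "diameter_prog = block [Const 1 1, Load 2 0 0, src_prog, min_prog, Const 5 4, Store 3 8 5,
     relax_prog, relax_prog, relax_prog, ecc_prog, outer_prog, cert_prog, Const 5 4, Sub 0 5 10]"

section \<open>Correctness and running time\<close>

text \<open>All constants and sums formed by the program stay within this bound, so overflow needs
  no further attention.\<close>

locale ram_input = connected_pair_graph G for G :: "nat pair_pre_digraph" +
  fixes adj :: "nat list list" and W :: nat
  assumes adj: "adjacency_lists G adj"
    and W: "length adj + length (concat adj) + 7 \<le> W"
begin

abbreviation n :: nat where "n \<equiv> length adj"
abbreviation M :: nat where "M \<equiv> length (concat adj)"

definition off :: "nat \<Rightarrow> nat" where "off v = length (concat (take v adj))"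
definition tgt :: "nat \<Rightarrow> nat" where "tgt e = concat adj ! e"
definition src :: "nat \<Rightarrow> nat" where "src e = (LEAST v. e < off (Suc v))"

lemma pverts_eq: "pverts G = {..<n}"
  using adj by (simp add: adjacency_lists_def)

lemma n_pos: "0 < n"
  using pverts_nonempty unfolding pverts_eq by (cases adj) simp_all

lemma off_0: "off 0 = 0" and off_n: "off n = M"
  by (simp_all add: off_def)

lemma off_Suc: "v < n \<Longrightarrow> off (Suc v) = off v + length (adj ! v)"
  by (simp add: off_def take_Suc_conv_app_nth)

lemma off_le_M: "off v \<le> M"
  unfolding off_def
  by (metis append_take_drop_id concat_append le_add1 length_append)

lemma off_mono: "v \<le> w \<Longrightarrow> off v \<le> off w"
proof (induction w)
  case (Suc w)
  have "off w \<le> off (Suc w)"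
    by (cases "w < n") (simp_all add: off_Suc, simp add: off_def)
  then show ?case using Suc by (cases "v = Suc w") auto
qed simp

lemma tgt_off: "v < n \<Longrightarrow> i < length (adj ! v) \<Longrightarrow> tgt (off v + i) = adj ! v ! i"
proof -
  assume v: "v < n" and i: "i < length (adj ! v)"
  have "concat adj = concat (take v adj) @ adj ! v @ concat (drop (Suc v) adj)"
    by (subst id_take_nth_drop[OF v]) simp
  then show ?thesis using i by (simp add: tgt_def off_def nth_append)
qed

lemma nbrs_eq: "v < n \<Longrightarrow> nbrs v = set (adj ! v)"
  using adj by (simp add: adjacency_lists_def)

lemma bij_tgt: "v < n \<Longrightarrow> bij_betw tgt {off v..<off (Suc v)} (nbrs v)"
proof -
  assume v: "v < n"
  have "bij_betw ((!) (adj ! v)) {..<length (adj ! v)} (set (adj ! v))"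
    using adj v by (intro bij_betw_nth) (auto simp: adjacency_lists_def)
  moreover have "bij_betw (\<lambda>e. e - off v) {off v..<off (Suc v)} {..<length (adj ! v)}"
    by (rule bij_betwI[where g = "\<lambda>i. off v + i"]) (auto simp: off_Suc v)
  ultimately have "bij_betw ((!) (adj ! v) \<circ> (\<lambda>e. e - off v)) {off v..<off (Suc v)} (nbrs v)"
    unfolding nbrs_eq[OF v] by (rule bij_betw_trans[rotated])
  moreover have "((!) (adj ! v) \<circ> (\<lambda>e. e - off v)) e = tgt e" if "e \<in> {off v..<off (Suc v)}" for e
    using tgt_off[OF v, of "e - off v"] off_Suc[OF v] that by (simp add: less_diff_conv2)
  ultimately show ?thesis using bij_betw_cong by blast
qed

lemma tgt_image: "v < n \<Longrightarrow> tgt ` {off v..<off (Suc v)} = nbrs v"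
  using bij_tgt by (simp add: bij_betw_def)

lemma card_nbrs: "v < n \<Longrightarrow> card (nbrs v) = off (Suc v) - off v"
  using bij_betw_same_card[OF bij_tgt] by fastforce

lemma card_nbrs_less: "v < n \<Longrightarrow> card (nbrs v) < n"
proof -
  assume "v < n"
  then have "nbrs v \<subseteq> {..<n} - {v}" using nbrs_subset no_loop pverts_eq by auto
  then have "card (nbrs v) \<le> card ({..<n} - {v})" by (rule card_mono[rotated]) simp
  then show ?thesis using \<open>v < n\<close> by simp
qed

lemma src_eqI: "v < n \<Longrightarrow> off v \<le> e \<Longrightarrow> e < off (Suc v) \<Longrightarrow> src e = v"
  unfolding src_def
proof (rule Least_equality)
  fix w assume "off v \<le> e" "e < off (Suc w)"
  then show "v \<le> w" using off_mono[of "Suc w" v] by (meson leD le_trans not_less_eq_eq)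
qed auto

lemma src: assumes "e < M" shows "src e < n" "off (src e) \<le> e" "e < off (Suc (src e))"
proof -
  have "e < off (Suc (n - 1))" using assms off_n n_pos by simp
  then have "src e \<le> n - 1" and *: "e < off (Suc (src e))"
    unfolding src_def by (rule Least_le, rule LeastI)
  show "e < off (Suc (src e))" by (rule *)
  show "src e < n" using \<open>src e \<le> n - 1\<close> n_pos by linarith
  show "off (src e) \<le> e"
  proof (cases "src e")
    case (Suc w)
    then have "\<not> e < off (Suc w)" using not_less_Least[of w "\<lambda>v. e < off (Suc v)"] by (simp add: src_def)
    then show ?thesis using Suc by simp
  qed (simp add: off_0)
qed

text \<open>Addresses below \<open>M\<close> stand for arcs, so a loop over all arcs runs through an
  interval.\<close>

lemma arc_iff: "(z, w) \<in> parcs G \<longleftrightarrow> (\<exists>e<M. src e = z \<and> tgt e = w)"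
proof
  assume a: "(z, w) \<in> parcs G"
  then have z: "z < n" using in_arcsD1 pverts_eq by auto
  then have "w \<in> tgt ` {off z..<off (Suc z)}" using a by (simp add: tgt_image)
  then obtain e where e: "off z \<le> e" "e < off (Suc z)" "tgt e = w" by auto
  then show "\<exists>e<M. src e = z \<and> tgt e = w"
    using src_eqI[OF z] off_le_M[of "Suc z"] by (intro exI[of _ e]) simp
next
  assume "\<exists>e<M. src e = z \<and> tgt e = w"
  then obtain e where e: "e < M" "src e = z" "tgt e = w" by blast
  then have "tgt e \<in> nbrs z" using tgt_image[OF src(1)] src[OF e(1)] by force
  then show "(z, w) \<in> parcs G" using e by simp
qed

lemma tgt_less: "e < M \<Longrightarrow> tgt e < n"
  using arc_iff[of "src e" "tgt e"] in_arcsD2 pverts_eq by blast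

definition input_ready :: "ram_state \<Rightarrow> bool" where
  "input_ready s \<longleftrightarrow> reg s 0 = n \<and> reg s 1 = 1 \<and> reg s 2 = M \<and>
     (\<forall>v\<le>n. arr s 0 v = off v) \<and> (\<forall>e<M. arr s 1 e = tgt e)"

definition arcs_ready :: "ram_state \<Rightarrow> bool" where
  "arcs_ready s \<longleftrightarrow> input_ready s \<and> (\<forall>e<M. arr s 2 e = src e)"

lemma input_ready_frame:
  "input_ready s \<Longrightarrow> frame c s s' \<Longrightarrow> written_regs c \<inter> {0, 1, 2} = {} \<Longrightarrow>
     written_arrs c \<inter> {0, 1} = {} \<Longrightarrow> input_ready s'"
  unfolding input_ready_def frame_def by auto

lemma arcs_ready_frame:
  "arcs_ready s \<Longrightarrow> frame c s s' \<Longrightarrow> written_regs c \<inter> {0, 1, 2} = {} \<Longrightarrow>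
     written_arrs c \<inter> {0, 1, 2} = {} \<Longrightarrow> arcs_ready s'"
  using input_ready_frame[of s c s'] unfolding arcs_ready_def frame_def by auto

text \<open>Each round either records the tail of an arc or advances to the next vertex, which gives
  \<open>n + M\<close> rounds.\<close>

lemma runs_src_prog:
  assumes "input_ready s"
  shows "runs W src_prog s (10 * (n + M) + 3) arcs_ready"
  unfolding src_prog_def block.simps
proof (rule runs_Seq_straight, simp, simp, rule runs_Seq_straight, simp, simp)
  let ?s = "eval_com (Const 4 0) (eval_com (Const 3 0) s)"
  have s: "input_ready ?s" using assms by (simp add: input_ready_def)
  show "runs W (While (Less 3 2) src_loop) ?s (10 * (n + M) + 3 - cost (Const 3 0) - cost (Const 4 0)) arcs_ready"
  proof (rule runs_While_straight[where N = "n + M" and \<mu> = "\<lambda>s'. M - reg s' 3 + (n - reg s' 4)" and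
        I = "\<lambda>s'. reg s' 4 \<le> n \<and> off (reg s' 4) \<le> reg s' 3 \<and> reg s' 3 \<le> M \<and>
           (\<forall>e < reg s' 3. arr s' 2 e = src e)"])
    fix s' assume I: "reg s' 4 \<le> n \<and> off (reg s' 4) \<le> reg s' 3 \<and> reg s' 3 \<le> M \<and>
           (\<forall>e < reg s' 3. arr s' 2 e = src e)" and f: "frame src_loop ?s s'"
      and h: "holds (Less 3 2) s'"
    have r: "input_ready s'" by (rule input_ready_frame[OF s f]) (simp_all add: src_loop_def)
    then have lt: "reg s' 3 < M" using h by (simp add: input_ready_def)
    \<comment> \<open>The current vertex cannot run past the last one while arcs remain, since
      \<open>off n = M\<close>.\<close>
    have "reg s' 4 \<noteq> n" using I lt off_n by auto
    then have lt4: "reg s' 4 < n" using I by simp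
    have src4: "src (reg s' 3) = reg s' 4" if "reg s' 3 < off (Suc (reg s' 4))"
      using src_eqI[OF lt4] I that by simp
    show "safe W src_loop s' \<and> (reg (eval_com src_loop s') 4 \<le> n \<and>
        off (reg (eval_com src_loop s') 4) \<le> reg (eval_com src_loop s') 3 \<and>
        reg (eval_com src_loop s') 3 \<le> M \<and>
        (\<forall>e < reg (eval_com src_loop s') 3. arr (eval_com src_loop s') 2 e = src e)) \<and>
        M - reg (eval_com src_loop s') 3 + (n - reg (eval_com src_loop s') 4) < M - reg s' 3 + (n - reg s' 4)"
      using r I lt lt4 src4 W unfolding src_loop_def
      by (auto simp: input_ready_def less_Suc_eq)
  next
    fix s' assume I: "reg s' 4 \<le> n \<and> off (reg s' 4) \<le> reg s' 3 \<and> reg s' 3 \<le> M \<and>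
           (\<forall>e < reg s' 3. arr s' 2 e = src e)" and f: "frame src_loop ?s s'"
      and h: "\<not> holds (Less 3 2) s'"
    have r: "input_ready s'" by (rule input_ready_frame[OF s f]) (simp_all add: src_loop_def)
    then show "arcs_ready s'" using I h unfolding arcs_ready_def by (simp add: input_ready_def)
  qed (simp_all add: off_0 src_loop_def)
qed

text \<open>Register 7 starts at \<open>n\<close>, above every degree, so vertex 0 is always taken
  first.\<close>

lemma runs_min_prog:
  assumes "arcs_ready s"
  shows "runs W min_prog s (12 * n + 4)
    (\<lambda>s'. arcs_ready s' \<and> reg s' 8 < n \<and> (\<forall>v<n. card (nbrs (reg s' 8)) \<le> card (nbrs v)))"
  unfolding min_prog_def block.simps
proof (rule runs_Seq_straight, simp, simp, rule runs_Seq_straight, simp, simp, rule runs_Seq_straight, simp, simp)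
  let ?s = "eval_com (Const 8 0) (eval_com (Move 7 0) (eval_com (Const 3 0) s))"
  let ?I = "\<lambda>s'. reg s' 3 \<le> n \<and> reg s' 8 < n \<and> (\<forall>v < reg s' 3. reg s' 7 \<le> card (nbrs v)) \<and>
     (0 < reg s' 3 \<longrightarrow> reg s' 7 = card (nbrs (reg s' 8))) \<and> (reg s' 3 = 0 \<longrightarrow> reg s' 7 = n)"
  let ?T = "12 * n + 4 - cost (Const 3 0) - cost (Move 7 0) - cost (Const 8 0)"
  let ?Q = "\<lambda>s'. arcs_ready s' \<and> reg s' 8 < n \<and> (\<forall>v<n. card (nbrs (reg s' 8)) \<le> card (nbrs v))"
  have s: "arcs_ready ?s" using assms by (simp add: arcs_ready_def input_ready_def)
  show "runs W (While (Less 3 0) min_loop) ?s ?T ?Q"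
  proof (rule runs_While_straight[where N = n and \<mu> = "\<lambda>s'. n - reg s' 3" and I = ?I])
    fix s' assume I: "?I s'" and f: "frame min_loop ?s s'" and h: "holds (Less 3 0) s'"
    have r: "arcs_ready s'" by (rule arcs_ready_frame[OF s f]) (simp_all add: min_loop_def)
    then have lt: "reg s' 3 < n" using h by (simp add: arcs_ready_def input_ready_def)
    have deg: "off (Suc (reg s' 3)) - off (reg s' 3) = card (nbrs (reg s' 3))"
      "card (nbrs (reg s' 3)) < n" using card_nbrs[OF lt] card_nbrs_less[OF lt] by simp_all
    show "safe W min_loop s' \<and> ?I (eval_com min_loop s') \<and> n - reg (eval_com min_loop s') 3 < n - reg s' 3"
      using r I lt deg W unfolding min_loop_def
      by (auto simp: arcs_ready_def input_ready_def less_Suc_eq)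
  next
    fix s' assume I: "?I s'" and f: "frame min_loop ?s s'" and h: "\<not> holds (Less 3 0) s'"
    have r: "arcs_ready s'" by (rule arcs_ready_frame[OF s f]) (simp_all add: min_loop_def)
    then show "?Q s'" using I h n_pos by (auto simp: arcs_ready_def input_ready_def)
  qed (use n_pos assms in \<open>simp_all add: arcs_ready_def input_ready_def min_loop_def\<close>)
qed

section \<open>Distances from one vertex and its eccentricity\<close>

lemma near_hops: "u < n \<Longrightarrow> v < n \<Longrightarrow> near k u v \<longleftrightarrow> hops u v \<le> k"
  using near_iff_hops pverts_eq by auto

lemma hops_arc: "x < n \<Longrightarrow> (z, w) \<in> parcs G \<Longrightarrow> hops x w \<le> Suc (hops x z)"
proof -
  assume x: "x < n" and a: "(z, w) \<in> parcs G"
  then have zw: "z < n" "w < n" using in_arcsD1 in_arcsD2 pverts_eq by blast+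
  then have "near (hops x z) x z" using near_hops[OF x] by simp
  then have "near (Suc (hops x z)) x w" using a by auto
  then show ?thesis using near_hops[OF x zw(2)] by simp
qed

lemma hops_pred:
  assumes "x < n" "w < n" "hops x w = Suc k"
  obtains z where "(z, w) \<in> parcs G" "hops x z \<le> k"
proof -
  have "near (Suc k) x w" "\<not> near k x w" using near_hops[OF assms(1,2)] assms(3) by auto
  then obtain z where z: "near k x z" "(z, w) \<in> parcs G" by auto
  then have "z < n" using in_arcsD1 pverts_eq by blast
  then show ?thesis using that z near_hops[OF assms(1)] by blast
qed

text \<open>The entries of array 3 are truncated at 0, so the zero-initialised array is correct for the
  vertices not reached yet. Three passes suffice, as distances above 3 all have the entry 0.\<close>

definition level :: "nat \<Rightarrow> nat \<Rightarrow> ram_state \<Rightarrow> bool" where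
  "level x i s \<longleftrightarrow> arcs_ready s \<and> reg s 8 = x \<and>
     (\<forall>v<n. arr s 3 v \<le> 4 - hops x v \<and> (hops x v \<le> i \<longrightarrow> arr s 3 v = 4 - hops x v))"

text \<open>Entries only grow and never exceed the true value. The invariant compares with the
  entries at the start of the pass, as the entry of a tail may have grown since.\<close>

lemma runs_relax_prog:
  assumes x: "x < n" and L: "level x i s"
  shows "runs W relax_prog s (12 * M + 2) (level x (Suc i))"
  unfolding relax_prog_def block.simps
proof (rule runs_Seq_straight, simp, simp)
  let ?s = "eval_com (Const 3 0) s"
  let ?I = "\<lambda>s'. reg s' 3 \<le> M \<and> (\<forall>v<n. arr s 3 v \<le> arr s' 3 v \<and> arr s' 3 v \<le> 4 - hops x v) \<and>
     (\<forall>e < reg s' 3. arr s 3 (src e) - 1 \<le> arr s' 3 (tgt e))"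
  have s: "arcs_ready ?s" using L by (simp add: level_def arcs_ready_def input_ready_def)
  show "runs W (While (Less 3 2) relax_loop) ?s (12 * M + 2 - cost (Const 3 0)) (level x (Suc i))"
  proof (rule runs_While_straight[where N = M and \<mu> = "\<lambda>s'. M - reg s' 3" and I = ?I])
    fix s' assume I: "?I s'" and f: "frame relax_loop ?s s'" and h: "holds (Less 3 2) s'"
    have r: "arcs_ready s'" by (rule arcs_ready_frame[OF s f]) (simp_all add: relax_loop_def)
    then have lt: "reg s' 3 < M" using h by (simp add: arcs_ready_def input_ready_def)
    let ?z = "src (reg s' 3)" and ?w = "tgt (reg s' 3)"
    have z: "?z < n" and w: "?w < n" using src[OF lt] tgt_less[OF lt] by auto
    have "hops x ?w \<le> Suc (hops x ?z)" using hops_arc[OF x] arc_iff lt by blast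
    moreover have Iz: "arr s' 3 ?z \<le> 4 - hops x ?z" "arr s 3 ?z \<le> arr s' 3 ?z" using I z by simp_all
    ultimately have le: "arr s' 3 ?z - 1 \<le> 4 - hops x ?w" by linarith
    have step: "reg (eval_com relax_loop s') 3 = reg s' 3 + 1"
      "arr (eval_com relax_loop s') 3 = (if arr s' 3 ?w < arr s' 3 ?z - 1
         then (arr s' 3)(?w := arr s' 3 ?z - 1) else arr s' 3)"
      using r lt by (simp_all add: relax_loop_def arcs_ready_def input_ready_def)
    have mono: "arr s' 3 v \<le> arr (eval_com relax_loop s') 3 v" for v
      unfolding step by simp
    have "?I (eval_com relax_loop s')"
    proof (intro conjI allI impI)
      show "reg (eval_com relax_loop s') 3 \<le> M" unfolding step using lt by simp
      show "arr s 3 v \<le> arr (eval_com relax_loop s') 3 v" if "v < n" for v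
        using I that mono[of v] le_trans by blast
      show "arr (eval_com relax_loop s') 3 v \<le> 4 - hops x v" if "v < n" for v
        unfolding step using I that le by simp
      fix e assume e: "e < reg (eval_com relax_loop s') 3"
      show "arr s 3 (src e) - 1 \<le> arr (eval_com relax_loop s') 3 (tgt e)"
      proof (cases "e = reg s' 3")
        case True
        have "arr s' 3 ?z - 1 \<le> arr (eval_com relax_loop s') 3 ?w" unfolding step by simp
        then show ?thesis using Iz True by simp
      next
        case False
        then have "e < reg s' 3" using e unfolding step by simp
        then show ?thesis using I mono[of "tgt e"] le_trans by blast
      qed
    qed
    moreover have "safe W relax_loop s'"
      using r lt W by (simp add: relax_loop_def arcs_ready_def input_ready_def)
    moreover have "M - reg (eval_com relax_loop s') 3 < M - reg s' 3"
      unfolding step using lt by simp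
    ultimately show "safe W relax_loop s' \<and> ?I (eval_com relax_loop s') \<and>
       M - reg (eval_com relax_loop s') 3 < M - reg s' 3" by blast
  next
    fix s' assume I: "?I s'" and f: "frame relax_loop ?s s'" and h: "\<not> holds (Less 3 2) s'"
    have r: "arcs_ready s'" by (rule arcs_ready_frame[OF s f]) (simp_all add: relax_loop_def)
    then have eq: "reg s' 3 = M" using h I by (simp add: arcs_ready_def input_ready_def)
    have "reg s' 8 = x" using f L by (simp add: frame_def relax_loop_def level_def)
    moreover have "arr s' 3 v = 4 - hops x v" if v: "v < n" "hops x v \<le> Suc i" for v
    proof (cases "hops x v \<le> i")
      case True
      then have "arr s 3 v = 4 - hops x v" using L v by (simp add: level_def)
      moreover have "arr s 3 v \<le> arr s' 3 v" "arr s' 3 v \<le> 4 - hops x v" using I v(1) by blast+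
      ultimately show ?thesis by simp
    next
      case False
      then have Suc: "hops x v = Suc i" using v by simp
      \<comment> \<open>The predecessor \<open>z\<close> had its exact entry before the pass, and
        its arc to \<open>v\<close> passes it on.\<close>
      obtain z where z: "(z, v) \<in> parcs G" "hops x z \<le> i" using hops_pred[OF x v(1) Suc] .
      then obtain e where e: "e < M" "src e = z" "tgt e = v" using arc_iff by blast
      have "z < n" using src(1)[OF e(1)] e(2) by simp
      then have "arr s 3 z = 4 - hops x z" using L z(2) unfolding level_def by blast
      moreover have "arr s 3 (src e) - 1 \<le> arr s' 3 (tgt e)" using I e(1) eq by simp
      then have "arr s 3 z - 1 \<le> arr s' 3 v" unfolding e(2,3) .
      moreover have "arr s' 3 v \<le> 4 - hops x v" using I v(1) by blast
      ultimately show ?thesis using Suc z(2) by linarith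
    qed
    ultimately show "level x (Suc i) s'" using r I by (simp add: level_def)
  qed (use L in \<open>simp_all add: relax_loop_def level_def\<close>)
qed

definition dist_ready :: "nat \<Rightarrow> ram_state \<Rightarrow> bool" where
  "dist_ready x s \<longleftrightarrow> arcs_ready s \<and> reg s 8 = x \<and> (\<forall>v<n. arr s 3 v = 4 - hops x v)"

lemma level_3: "level x 3 s \<Longrightarrow> dist_ready x s"
proof -
  assume L: "level x 3 s"
  have "arr s 3 v = 4 - hops x v" if "v < n" for v
  proof (cases "hops x v \<le> 3")
    case False
    moreover have "arr s 3 v \<le> 4 - hops x v" using L that by (simp add: level_def)
    ultimately show ?thesis by linarith
  qed (use L that in \<open>simp add: level_def\<close>)
  then show ?thesis using L by (simp add: level_def dist_ready_def)
qed

lemma dist_ready_frame: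
  "dist_ready x s \<Longrightarrow> frame c s s' \<Longrightarrow> written_regs c \<inter> {0, 1, 2, 8} = {} \<Longrightarrow>
     written_arrs c \<inter> {0, 1, 2, 3} = {} \<Longrightarrow> dist_ready x s'"
  using arcs_ready_frame[of s c s'] unfolding dist_ready_def frame_def by auto

lemma runs_ecc_prog:
  assumes x: "x < n" and d: "dist_ready x s"
  shows "runs W ecc_prog s (6 * n + 3)
    (\<lambda>s'. dist_ready x s' \<and> (\<forall>v<n. reg s' 10 \<le> 4 - hops x v) \<and> (\<exists>v<n. reg s' 10 = 4 - hops x v))"
  unfolding ecc_prog_def block.simps
proof (rule runs_Seq_straight, simp, simp, rule runs_Seq_straight, use W in simp, simp)
  let ?s = "eval_com (Const 10 4) (eval_com (Const 3 0) s)"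
  let ?I = "\<lambda>s'. reg s' 3 \<le> n \<and> (\<forall>v < reg s' 3. reg s' 10 \<le> 4 - hops x v) \<and>
     (\<exists>v<n. reg s' 10 = 4 - hops x v)"
  let ?T = "6 * n + 3 - cost (Const 3 0) - cost (Const 10 4)"
  let ?Q = "\<lambda>s'. dist_ready x s' \<and> (\<forall>v<n. reg s' 10 \<le> 4 - hops x v) \<and> (\<exists>v<n. reg s' 10 = 4 - hops x v)"
  have s: "dist_ready x ?s" using d by (simp add: dist_ready_def arcs_ready_def input_ready_def)
  \<comment> \<open>The initial value 4 is the entry of \<open>x\<close> itself, so the minimum is
    attained from the start.\<close>
  have "hops x x \<le> 0" using near_hops[OF x x, of 0] by simp
  then have i: "\<exists>v<n. 4 = 4 - hops x v" using x by (intro exI[of _ x]) simp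
  show "runs W (While (Less 3 0) ecc_loop) ?s ?T ?Q"
  proof (rule runs_While_straight[where N = n and \<mu> = "\<lambda>s'. n - reg s' 3" and I = ?I])
    fix s' assume I: "?I s'" and f: "frame ecc_loop ?s s'" and h: "holds (Less 3 0) s'"
    have r: "dist_ready x s'" by (rule dist_ready_frame[OF s f]) (simp_all add: ecc_loop_def)
    then have lt: "reg s' 3 < n" using h by (simp add: dist_ready_def arcs_ready_def input_ready_def)
    show "safe W ecc_loop s' \<and> ?I (eval_com ecc_loop s') \<and> n - reg (eval_com ecc_loop s') 3 < n - reg s' 3"
      using r I lt W unfolding ecc_loop_def
      by (auto simp: dist_ready_def arcs_ready_def input_ready_def less_Suc_eq)
  next
    fix s' assume I: "?I s'" and f: "frame ecc_loop ?s s'" and h: "\<not> holds (Less 3 0) s'"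
    have r: "dist_ready x s'" by (rule dist_ready_frame[OF s f]) (simp_all add: ecc_loop_def)
    then show "?Q s'" using I h by (auto simp: dist_ready_def arcs_ready_def input_ready_def)
  qed (use i in \<open>simp_all add: ecc_loop_def\<close>)
qed

section \<open>Outer degrees\<close>

lemma hops_gt_1: "x < n \<Longrightarrow> v < n \<Longrightarrow> 4 - hops x v < 3 \<longleftrightarrow> v \<notin> nbrs x \<and> v \<noteq> x"
  using near_hops[of x v 1] by auto

text \<open>The arcs counted for \<open>z\<close> once the first \<open>k\<close> arcs have been
  scanned.\<close>

definition outer_arcs :: "nat \<Rightarrow> nat \<Rightarrow> nat \<Rightarrow> nat set" where
  "outer_arcs x k z = {e. e < k \<and> src e = z \<and> 4 - hops x (tgt e) < 3}"

lemma finite_outer_arcs: "finite (outer_arcs x k z)"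
  by (rule finite_subset[of _ "{..<k}"]) (auto simp: outer_arcs_def)

lemma card_outer_arcs_le: "card (outer_arcs x k z) \<le> k"
  using card_mono[of "{..<k}" "outer_arcs x k z"] by (auto simp: outer_arcs_def)

lemma card_outer_arcs_Suc:
  "card (outer_arcs x (Suc k) z) =
     (if src k = z \<and> 4 - hops x (tgt k) < 3 then Suc (card (outer_arcs x k z)) else card (outer_arcs x k z))"
proof (cases "src k = z \<and> 4 - hops x (tgt k) < 3")
  case True
  then have "outer_arcs x (Suc k) z = insert k (outer_arcs x k z)" by (auto simp: outer_arcs_def less_Suc_eq)
  moreover have "k \<notin> outer_arcs x k z" by (simp add: outer_arcs_def)
  ultimately show ?thesis using True finite_outer_arcs by simp
next
  case False
  then have "outer_arcs x (Suc k) z = outer_arcs x k z" by (auto simp: outer_arcs_def less_Suc_eq)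
  then show ?thesis using False by auto
qed

text \<open>Adjacency lists have no repetitions, so \<open>tgt\<close> is injective on the arcs at
  \<open>z\<close> and counting arcs counts neighbours.\<close>

lemma card_outer_arcs:
  assumes x: "x < n" and z: "z < n"
  shows "card (outer_arcs x M z) = outer_degree x z"
proof -
  have sub: "e \<in> {off z..<off (Suc z)} \<and> e < M" if "e \<in> outer_arcs x M z" for e
    using that src[of e] by (auto simp: outer_arcs_def)
  have inj: "inj_on tgt (outer_arcs x M z)"
    using bij_tgt[OF z] sub unfolding bij_betw_def by (blast intro: inj_on_subset)
  have "tgt ` outer_arcs x M z = nbrs z - nbrs x - {x}"
  proof (intro equalityI subsetI)
    fix w assume "w \<in> tgt ` outer_arcs x M z"
    then obtain e where e: "e \<in> outer_arcs x M z" "w = tgt e" by blast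
    then have "e < M" "src e = z" "4 - hops x w < 3" by (simp_all add: outer_arcs_def)
    then have "(z, w) \<in> parcs G" "w < n" using arc_iff e(2) tgt_less by auto
    then show "w \<in> nbrs z - nbrs x - {x}" using hops_gt_1[OF x, of w] \<open>4 - hops x w < 3\<close> by simp
  next
    fix w assume w: "w \<in> nbrs z - nbrs x - {x}"
    then obtain e where e: "e < M" "src e = z" "tgt e = w" using arc_iff by auto
    then have "w < n" using tgt_less by auto
    then have "e \<in> outer_arcs x M z" using e w hops_gt_1[OF x, of w] by (simp add: outer_arcs_def)
    then show "w \<in> tgt ` outer_arcs x M z" using e(3) by blast
  qed
  then show ?thesis unfolding outer_degree_def using card_image[OF inj] by simp
qed

definition prepared :: "nat \<Rightarrow> ram_state \<Rightarrow> bool" where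
  "prepared x s \<longleftrightarrow> dist_ready x s \<and> reg s 11 = 3 \<and> (\<forall>v<n. arr s 4 v = outer_degree x v)"

lemma prepared_frame:
  "prepared x s \<Longrightarrow> frame c s s' \<Longrightarrow> written_regs c \<inter> {0, 1, 2, 8, 11} = {} \<Longrightarrow>
     written_arrs c \<inter> {0, 1, 2, 3, 4} = {} \<Longrightarrow> prepared x s'"
  using dist_ready_frame[of x s c s'] unfolding prepared_def frame_def by auto

lemma runs_outer_prog:
  assumes x: "x < n" and d: "dist_ready x s" and z: "\<forall>v<n. arr s 4 v = 0"
  shows "runs W outer_prog s (10 * M + 3) (prepared x)"
  unfolding outer_prog_def block.simps
proof (rule runs_Seq_straight, use W in simp, simp, rule runs_Seq_straight, simp, simp)
  let ?s = "eval_com (Const 3 0) (eval_com (Const 11 3) s)"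
  let ?I = "\<lambda>s'. reg s' 3 \<le> M \<and> (\<forall>v<n. arr s' 4 v = card (outer_arcs x (reg s' 3) v))"
  let ?T = "10 * M + 3 - cost (Const 11 3) - cost (Const 3 0)"
  have s: "dist_ready x ?s" using d by (simp add: dist_ready_def arcs_ready_def input_ready_def)
  show "runs W (While (Less 3 2) outer_loop) ?s ?T (prepared x)"
  proof (rule runs_While_straight[where N = M and \<mu> = "\<lambda>s'. M - reg s' 3" and I = ?I])
    fix s' assume I: "?I s'" and f: "frame outer_loop ?s s'" and h: "holds (Less 3 2) s'"
    have r: "dist_ready x s'" by (rule dist_ready_frame[OF s f]) (simp_all add: outer_loop_def)
    then have lt: "reg s' 3 < M" using h by (simp add: dist_ready_def arcs_ready_def input_ready_def)
    have r11: "reg s' 11 = 3" using f by (simp add: frame_def outer_loop_def)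
    have "arr s' 4 (src (reg s' 3)) \<le> reg s' 3" using I src(1)[OF lt] card_outer_arcs_le by simp
    then have "Suc (arr s' 4 (src (reg s' 3))) \<le> W" using lt W by linarith
    then show "safe W outer_loop s' \<and> ?I (eval_com outer_loop s') \<and> M - reg (eval_com outer_loop s') 3 < M - reg s' 3"
      using r I lt W r11 src(1)[OF lt] tgt_less[OF lt] unfolding outer_loop_def
      by (auto simp: dist_ready_def arcs_ready_def input_ready_def card_outer_arcs_Suc)
  next
    fix s' assume I: "?I s'" and f: "frame outer_loop ?s s'" and h: "\<not> holds (Less 3 2) s'"
    have r: "dist_ready x s'" by (rule dist_ready_frame[OF s f]) (simp_all add: outer_loop_def)
    then have "reg s' 3 = M" using I h by (simp add: dist_ready_def arcs_ready_def input_ready_def)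
    moreover have "reg s' 11 = 3" using f by (simp add: frame_def outer_loop_def)
    ultimately show "prepared x s'" using r I card_outer_arcs[OF x] by (simp add: prepared_def)
  qed (use z in \<open>simp_all add: outer_loop_def outer_arcs_def\<close>)
qed

section \<open>Testing the neighbours of the minimum degree vertex\<close>

definition marked :: "nat \<Rightarrow> ram_state \<Rightarrow> bool" where
  "marked u s \<longleftrightarrow> (\<forall>v<n. arr s 5 v = reg s 14 \<longleftrightarrow> v = u \<or> v \<in> nbrs u)"

text \<open>All older marks are smaller than the stamp, so equality with the stamp singles out the
  vertices marked in this run.\<close>

lemma runs_mark_prog:
  assumes s: "arcs_ready s" and u: "reg s 13 = u" "u < n"
    and lt: "\<forall>v<n. arr s 5 v < reg s 14"
  shows "runs W mark_prog s (4 * n + 5) (\<lambda>s'. marked u s' \<and> (\<forall>v<n. arr s' 5 v \<le> reg s' 14))"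
  unfolding mark_prog_def block.simps
proof (rule runs_Seq_straight, simp, simp, rule runs_Seq_straight, simp, simp,
    rule runs_Seq_straight, use W u s in \<open>simp add: arcs_ready_def input_ready_def\<close>, simp,
    rule runs_Seq_straight, simp, simp)
  let ?s = "eval_com (Load 16 0 5) (eval_com (Add 5 13 1) (eval_com (Load 15 0 13) (eval_com (Store 5 13 14) s)))"
  let ?k = "reg s 14"
  let ?T = "4 * n + 5 - cost (Store 5 13 14) - cost (Load 15 0 13) - cost (Add 5 13 1) - cost (Load 16 0 5)"
  let ?I = "\<lambda>s'. off u \<le> reg s' 15 \<and> reg s' 15 \<le> off (Suc u) \<and> (\<forall>v<n. arr s' 5 v \<le> ?k) \<and>
     (\<forall>v<n. arr s' 5 v = ?k \<longleftrightarrow> v = u \<or> v \<in> tgt ` {off u..<reg s' 15})"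
  have s': "arcs_ready ?s" using s by (simp add: arcs_ready_def input_ready_def)
  have le: "off u \<le> off (Suc u)" by (rule off_mono) simp
  have s0: "reg ?s 15 = off u" "reg ?s 16 = off (Suc u)" "arr ?s 5 = (arr s 5)(u := ?k)"
    using s u by (simp_all add: arcs_ready_def input_ready_def)
  show "runs W (While (Less 15 16) mark_loop) ?s ?T (\<lambda>s'. marked u s' \<and> (\<forall>v<n. arr s' 5 v \<le> reg s' 14))"
  proof (rule runs_While_straight[where N = n and \<mu> = "\<lambda>s'. off (Suc u) - reg s' 15" and I = ?I])
    show "?I ?s" using lt le unfolding s0 by (auto intro: less_imp_le)
    show "off (Suc u) - reg ?s 15 \<le> n"
      unfolding s0 using card_nbrs[OF u(2)] card_nbrs_less[OF u(2)] by simp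
    fix s' assume I: "?I s'" and f: "frame mark_loop ?s s'" and h: "holds (Less 15 16) s'"
    have r: "arcs_ready s'" by (rule arcs_ready_frame[OF s' f]) (simp_all add: mark_loop_def)
    have f': "reg s' 14 = ?k" "reg s' 16 = off (Suc u)"
      using f s0 by (simp_all add: frame_def mark_loop_def)
    then have l: "reg s' 15 < off (Suc u)" using h by simp
    then have lM: "reg s' 15 < M" using off_le_M[of "Suc u"] by linarith
    have "{off u..<Suc (reg s' 15)} = insert (reg s' 15) {off u..<reg s' 15}" using I by auto
    then show "safe W mark_loop s' \<and> ?I (eval_com mark_loop s') \<and>
        off (Suc u) - reg (eval_com mark_loop s') 15 < off (Suc u) - reg s' 15"
      using r I f' l lM W unfolding mark_loop_def
      by (auto simp: arcs_ready_def input_ready_def)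
  next
    fix s' assume I: "?I s'" and f: "frame mark_loop ?s s'" and h: "\<not> holds (Less 15 16) s'"
    have f': "reg s' 14 = ?k" "reg s' 16 = off (Suc u)"
      using f s0 by (simp_all add: frame_def mark_loop_def)
    then have "reg s' 15 = off (Suc u)" using I h by simp
    then show "marked u s' \<and> (\<forall>v<n. arr s' 5 v \<le> reg s' 14)"
      using I f' tgt_image[OF u(2)] unfolding marked_def by simp
  qed (simp add: mark_loop_def)
qed

definition far_set :: "nat \<Rightarrow> nat \<Rightarrow> nat set" where
  "far_set x u = pverts G - nbrs x - {x} - nbrs u - {u}"

text \<open>The values for the empty set are the initial ones of the scan: \<open>n\<close> exceeds
  every outer degree, and the candidate \<open>u\<close> fails the test because its own neighbour
  \<open>x\<close> is marked.\<close>

definition least_outer :: "nat \<Rightarrow> nat \<Rightarrow> nat set \<Rightarrow> nat \<Rightarrow> nat \<Rightarrow> bool" where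
  "least_outer x u F v d \<longleftrightarrow> (if F = {} then v = u \<and> d = n
     else v \<in> F \<and> d = outer_degree x v \<and> (\<forall>z \<in> F. d \<le> outer_degree x z))"

definition picked :: "nat \<Rightarrow> nat \<Rightarrow> nat \<Rightarrow> bool" where
  "picked x u v \<longleftrightarrow> (\<exists>d. least_outer x u (far_set x u) v d)"

lemma outer_degree_less: "z < n \<Longrightarrow> outer_degree x z < n"
proof -
  assume z: "z < n"
  have "outer_degree x z \<le> card (nbrs z)"
    unfolding outer_degree_def by (rule card_mono[OF finite_nbrs]) auto
  then show ?thesis using card_nbrs_less[OF z] by simp
qed

lemma least_outer_insert:
  assumes "least_outer x u F v d" "z < n"
  shows "least_outer x u (insert z F) (if outer_degree x z < d then z else v)
    (if outer_degree x z < d then outer_degree x z else d)"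
proof (cases "F = {}")
  case False
  have "v \<in> F \<and> d = outer_degree x v \<and> (\<forall>z \<in> F. d \<le> outer_degree x z)"
    using assms(1) unfolding least_outer_def if_not_P[OF False] .
  then show ?thesis by (auto simp: least_outer_def)
qed (use assms outer_degree_less in \<open>simp add: least_outer_def\<close>)

lemma runs_pick_prog:
  assumes x: "x < n" and p: "prepared x s" and m: "marked u s" and u: "reg s 13 = u" "u < n"
  shows "runs W pick_prog s (15 * n + 4) (\<lambda>s'. picked x u (reg s' 17))"
  unfolding pick_prog_def block.simps
proof (rule runs_Seq_straight, simp, simp, rule runs_Seq_straight, simp, simp,
    rule runs_Seq_straight, simp, simp)
  let ?s = "eval_com (Const 15 0) (eval_com (Move 18 0) (eval_com (Move 17 13) s))"
  let ?T = "15 * n + 4 - cost (Move 17 13) - cost (Move 18 0) - cost (Const 15 0)"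
  let ?F = "\<lambda>k. {z \<in> far_set x u. z < k}"
  let ?I = "\<lambda>s'. reg s' 15 \<le> n \<and>
     least_outer x u (?F (reg s' 15)) (reg s' 17) (reg s' 18)"
  have p': "prepared x ?s"
    using p by (simp add: prepared_def dist_ready_def arcs_ready_def input_ready_def)
  \<comment> \<open>An entry below 3 in array 3 means distance above 1 from
    \<open>x\<close>.\<close>
  have far: "v \<in> far_set x u \<longleftrightarrow> 4 - hops x v < 3 \<and> arr s 5 v \<noteq> reg s 14" if "v < n" for v
    using hops_gt_1[OF x that] m that pverts_eq unfolding marked_def far_set_def by auto
  show "runs W (While (Less 15 0) pick_loop) ?s ?T (\<lambda>s'. picked x u (reg s' 17))"
  proof (rule runs_While_straight[where N = n and \<mu> = "\<lambda>s'. n - reg s' 15" and I = ?I])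
    show "?I ?s" using u p by (simp add: least_outer_def prepared_def dist_ready_def arcs_ready_def input_ready_def)
    fix s' assume I: "?I s'" and f: "frame pick_loop ?s s'" and h: "holds (Less 15 0) s'"
    have r: "prepared x s'" by (rule prepared_frame[OF p' f]) (simp_all add: pick_loop_def)
    then have r': "reg s' 0 = n" "reg s' 1 = 1" "reg s' 11 = 3"
      "\<And>v. v < n \<Longrightarrow> arr s' 3 v = 4 - hops x v" "\<And>v. v < n \<Longrightarrow> arr s' 4 v = outer_degree x v"
      by (simp_all add: prepared_def dist_ready_def arcs_ready_def input_ready_def)
    let ?v = "reg s' 15"
    have lt: "?v < n" using h r' by simp
    have f': "reg s' 14 = reg s 14" "arr s' 5 = arr s 5"
      using f by (simp_all add: frame_def pick_loop_def)
    have e15: "reg (eval_com pick_loop s') 15 = Suc ?v"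
      using r' by (simp add: pick_loop_def)
    have e: "reg (eval_com pick_loop s') 17 =
        (if ?v \<in> far_set x u \<and> outer_degree x ?v < reg s' 18 then ?v else reg s' 17)"
      "reg (eval_com pick_loop s') 18 =
        (if ?v \<in> far_set x u \<and> outer_degree x ?v < reg s' 18 then outer_degree x ?v else reg s' 18)"
      unfolding far[OF lt] using r' f' lt by (simp_all add: pick_loop_def)
    have F: "?F (Suc ?v) = (if ?v \<in> far_set x u then insert ?v (?F ?v) else ?F ?v)"
      by (auto simp: less_Suc_eq)
    have "?I (eval_com pick_loop s')"
    proof (cases "?v \<in> far_set x u")
      case False
      then show ?thesis using I lt unfolding e15 e F by simp
    next
      case True
      then show ?thesis
        using I lt least_outer_insert[OF conjunct2[OF I] lt] unfolding e15 e F by simp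
    qed
    moreover have "safe W pick_loop s'" using r' lt W by (simp add: pick_loop_def)
    ultimately show "safe W pick_loop s' \<and> ?I (eval_com pick_loop s') \<and>
        n - reg (eval_com pick_loop s') 15 < n - ?v"
      using lt e15 by simp
  next
    fix s' assume I: "?I s'" and f: "frame pick_loop ?s s'" and h: "\<not> holds (Less 15 0) s'"
    have r: "prepared x s'" by (rule prepared_frame[OF p' f]) (simp_all add: pick_loop_def)
    then have "reg s' 15 = n"
      using I h by (simp add: prepared_def dist_ready_def arcs_ready_def input_ready_def)
    moreover have "?F n = far_set x u" using pverts_eq by (auto simp: far_set_def)
    ultimately show "picked x u (reg s' 17)" using I unfolding picked_def by auto
  qed (simp_all add: pick_loop_def)
qed

lemma runs_test_prog:
  assumes s: "arcs_ready s" and m: "marked u s" and b: "reg s 17 = b" "b < n"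
  shows "runs W test_prog s (7 * n + 5)
    (\<lambda>s'. reg s' 19 = (if nbrs b \<inter> insert u (nbrs u) = {} then 1 else 0))"
  unfolding test_prog_def block.simps
proof (rule runs_Seq_straight, use W in simp, simp, rule runs_Seq_straight, simp, simp,
    rule runs_Seq_straight, use W b s in \<open>simp add: arcs_ready_def input_ready_def\<close>, simp,
    rule runs_Seq_straight, simp, simp)
  let ?s = "eval_com (Load 16 0 5) (eval_com (Add 5 17 1) (eval_com (Load 15 0 17) (eval_com (Const 19 1) s)))"
  let ?T = "7 * n + 5 - cost (Const 19 1) - cost (Load 15 0 17) - cost (Add 5 17 1) - cost (Load 16 0 5)"
  let ?I = "\<lambda>s'. off b \<le> reg s' 15 \<and> reg s' 15 \<le> off (Suc b) \<and>
     reg s' 19 = (if tgt ` {off b..<reg s' 15} \<inter> insert u (nbrs u) = {} then 1 else 0)"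
  let ?Q = "\<lambda>s'. reg s' 19 = (if nbrs b \<inter> insert u (nbrs u) = {} then 1 else 0)"
  have s': "arcs_ready ?s" using s by (simp add: arcs_ready_def input_ready_def)
  have le: "off b \<le> off (Suc b)" by (rule off_mono) simp
  have s0: "reg ?s 15 = off b" "reg ?s 16 = off (Suc b)" "reg ?s 19 = 1" "reg ?s 14 = reg s 14"
    using s b by (simp_all add: arcs_ready_def input_ready_def)
  show "runs W (While (Less 15 16) test_loop) ?s ?T ?Q"
  proof (rule runs_While_straight[where N = n and \<mu> = "\<lambda>s'. off (Suc b) - reg s' 15" and I = ?I])
    show "?I ?s" using le unfolding s0 by simp
    show "off (Suc b) - reg ?s 15 \<le> n"
      unfolding s0 using card_nbrs[OF b(2)] card_nbrs_less[OF b(2)] by simp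
    fix s' assume I: "?I s'" and f: "frame test_loop ?s s'" and h: "holds (Less 15 16) s'"
    have r: "arcs_ready s'" by (rule arcs_ready_frame[OF s' f]) (simp_all add: test_loop_def)
    have f': "reg s' 14 = reg s 14" "reg s' 16 = off (Suc b)" "arr s' 5 = arr s 5"
      using f s0 by (simp_all add: frame_def test_loop_def)
    let ?e = "reg s' 15"
    have l: "?e < off (Suc b)" using h f' by simp
    then have lM: "?e < M" using off_le_M[of "Suc b"] by linarith
    have r': "reg s' 1 = 1" "arr s' 1 ?e = tgt ?e"
      using r lM by (simp_all add: arcs_ready_def input_ready_def)
    have mk: "arr s 5 (tgt ?e) = reg s 14 \<longleftrightarrow> tgt ?e \<in> insert u (nbrs u)"
      using m tgt_less[OF lM] unfolding marked_def by simp
    have e15: "reg (eval_com test_loop s') 15 = Suc ?e"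
      using r' by (simp add: test_loop_def)
    have e19: "reg (eval_com test_loop s') 19 = (if tgt ?e \<in> insert u (nbrs u) then 0 else reg s' 19)"
      unfolding mk[symmetric] using r' f' by (simp add: test_loop_def)
    have E: "tgt ` {off b..<Suc ?e} = insert (tgt ?e) (tgt ` {off b..<?e})"
      using I by (subst atLeastLessThanSuc) auto
    have "?I (eval_com test_loop s')"
      unfolding e15 e19 E using I l by (cases "tgt ?e \<in> insert u (nbrs u)") simp_all
    moreover have "safe W test_loop s'" using r' lM W by (simp add: test_loop_def)
    ultimately show "safe W test_loop s' \<and> ?I (eval_com test_loop s') \<and>
        off (Suc b) - reg (eval_com test_loop s') 15 < off (Suc b) - ?e"
      using l e15 by simp
  next
    fix s' assume I: "?I s'" and f: "frame test_loop ?s s'" and h: "\<not> holds (Less 15 16) s'"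
    have "reg s' 16 = off (Suc b)" using f s0 by (simp add: frame_def test_loop_def)
    then have "reg s' 15 = off (Suc b)" using I h by simp
    then show "?Q s'" using I tgt_image[OF b(2)] by simp
  qed (simp add: test_loop_def)
qed

lemma picked_less: "picked x u v \<Longrightarrow> u < n \<Longrightarrow> v < n"
  unfolding picked_def least_outer_def far_set_def pverts_eq by (auto split: if_splits)

text \<open>Soundness of the test, independent of any forbidden subgraph.\<close>

lemma picked_far:
  assumes "picked x u v" "u \<in> nbrs x" "nbrs v \<inter> insert u (nbrs u) = {}"
  shows "v \<in> pverts G" "\<not> near 2 u v"
proof -
  have "far_set x u \<noteq> {}"
  proof
    assume "far_set x u = {}"
    then have "v = u" using assms(1) by (auto simp: picked_def least_outer_def)
    moreover have "x \<in> nbrs u" using assms(2) parcs_sym by simp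
    ultimately show False using assms(3) by auto
  qed
  then have v: "v \<in> far_set x u" using assms(1) by (auto simp: picked_def least_outer_def)
  then show "v \<in> pverts G" by (simp add: far_set_def)
  show "\<not> near 2 u v"
  proof
    assume "near 2 u v"
    then consider "u = v" | "(u, v) \<in> parcs G" | z where "(u, z) \<in> parcs G" "(z, v) \<in> parcs G"
      unfolding near_2 by blast
    then show False
    proof cases
      case 3
      then have "z \<in> nbrs v \<inter> insert u (nbrs u)" using parcs_sym by auto
      then show False using assms(3) by simp
    qed (use v in \<open>auto simp: far_set_def\<close>)
  qed
qed

text \<open>Completeness of the test: strictness of the minimum leaves the scan no other choice than
  the vertex of the certificate.\<close>

lemma picked_certificate:
  assumes "picked x u v" "certificate x u"
  shows "nbrs v \<inter> insert u (nbrs u) = {}"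
proof -
  obtain w where w: "w \<in> far_set x u" "\<not> near 2 u w"
    and least: "\<And>z. z \<in> far_set x u \<Longrightarrow> z \<noteq> w \<Longrightarrow> outer_degree x w < outer_degree x z"
    using assms(2) unfolding certificate_def far_set_def by blast
  have "v \<in> far_set x u" "outer_degree x v \<le> outer_degree x w"
    using assms(1) w(1) unfolding picked_def least_outer_def by (auto split: if_splits)
  then have "v = w" using least by fastforce
  then show ?thesis using far_2[OF w(2)] by auto
qed

text \<open>The loop invariant, \<open>k\<close> being the next address: the second conjunct is
  soundness of a change, the third completeness for the neighbours already tested.\<close>

definition witnessed :: "nat \<Rightarrow> nat \<Rightarrow> nat \<Rightarrow> nat \<Rightarrow> bool" where
  "witnessed x r0 k r \<longleftrightarrow> r \<le> r0 \<and>
     (r < r0 \<longrightarrow> r = 1 \<and> (\<exists>u \<in> pverts G. \<exists>v \<in> pverts G. \<not> near 2 u v)) \<and>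
     (\<forall>e. off x \<le> e \<longrightarrow> e < k \<longrightarrow> certificate x (tgt e) \<longrightarrow> r \<le> 1)"

lemma witnessed_Suc:
  assumes w: "witnessed x r0 k r" and p: "picked x (tgt k) v" and u: "tgt k \<in> nbrs x"
  shows "witnessed x r0 (Suc k)
    (if nbrs v \<inter> insert (tgt k) (nbrs (tgt k)) = {} \<and> 1 < r then 1 else r)"
proof (cases "nbrs v \<inter> insert (tgt k) (nbrs (tgt k)) = {}")
  case True
  have "tgt k \<in> pverts G" using u nbrs_subset by blast
  then have far: "\<exists>u \<in> pverts G. \<exists>v \<in> pverts G. \<not> near 2 u v" using picked_far[OF p u True] by blast
  show ?thesis
  proof (cases "1 < r")
    case 1: True
    have "r \<le> r0" using w by (simp add: witnessed_def)
    then show ?thesis using True 1 far by (simp add: witnessed_def)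
  next
    case False
    then show ?thesis using True w by (auto simp: witnessed_def)
  qed
next
  case False
  then have "\<not> certificate x (tgt k)" using picked_certificate[OF p] by blast
  then show ?thesis using False w by (auto simp: witnessed_def less_Suc_eq)
qed

text \<open>Marking, picking and testing take \<open>4 * n + 5\<close>, \<open>15 * n + 4\<close>
  and \<open>7 * n + 5\<close> steps, the remaining instructions 6.\<close>

lemma runs_cert_loop:
  assumes x: "x < n" and p: "prepared x s" and w: "witnessed x r0 (reg s 3) (reg s 10)"
    and e: "off x \<le> reg s 3" "reg s 3 < off (Suc x)"
    and lt: "\<forall>v<n. arr s 5 v \<le> reg s 3"
  shows "runs W cert_loop s (26 * n + 20) (\<lambda>s'. reg s' 3 = Suc (reg s 3) \<and>
     witnessed x r0 (Suc (reg s 3)) (reg s' 10) \<and> (\<forall>v<n. arr s' 5 v \<le> Suc (reg s 3)))"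
proof -
  let ?e = "reg s 3"
  define u where "u = tgt ?e"
  have eM: "?e < M" using e off_le_M[of "Suc x"] by linarith
  have un: "u < n" unfolding u_def by (rule tgt_less[OF eM])
  have ux: "u \<in> nbrs x" unfolding u_def tgt_image[OF x, symmetric] using e by simp
  let ?s0 = "eval_com (Add 14 3 1) (eval_com (Load 13 1 3) s)"
  have p0: "prepared x ?s0"
    using p by (simp add: prepared_def dist_ready_def arcs_ready_def input_ready_def)
  have one: "reg s 1 = 1" and ue: "arr s 1 ?e = u"
    using p eM by (simp_all add: prepared_def dist_ready_def arcs_ready_def input_ready_def u_def)
  let ?P1 = "\<lambda>s'. prepared x s' \<and> marked u s' \<and> reg s' 13 = u \<and>
     reg s' 3 = ?e \<and> reg s' 10 = reg s 10 \<and> (\<forall>v<n. arr s' 5 v \<le> Suc ?e)"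
  let ?P2 = "\<lambda>s'. ?P1 s' \<and> picked x u (reg s' 17)"
  let ?P3 = "\<lambda>s'. prepared x s' \<and> reg s' 3 = ?e \<and> reg s' 10 = reg s 10 \<and>
     (\<forall>v<n. arr s' 5 v \<le> Suc ?e) \<and>
     (\<exists>v. picked x u v \<and> reg s' 19 = (if nbrs v \<inter> insert u (nbrs u) = {} then 1 else 0))"
  let ?Q = "\<lambda>s'. reg s' 3 = Suc ?e \<and> witnessed x r0 (Suc ?e) (reg s' 10) \<and> (\<forall>v<n. arr s' 5 v \<le> Suc ?e)"
  have 1: "runs W mark_prog ?s0 (4 * n + 5) ?P1"
  proof (rule runs_mono[OF runs_frame[OF runs_mark_prog]])
    show "arcs_ready ?s0" using p0 by (simp add: prepared_def dist_ready_def)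
    show "reg ?s0 13 = u" using ue by simp
    show "\<forall>v<n. arr ?s0 5 v < reg ?s0 14" using lt one by (simp add: less_Suc_eq_le)
    fix s' assume a: "(marked u s' \<and> (\<forall>v<n. arr s' 5 v \<le> reg s' 14)) \<and> frame mark_prog ?s0 s'"
    then have "prepared x s'"
      by (intro prepared_frame[OF p0]) (auto simp: mark_prog_def mark_loop_def)
    moreover have "reg s' 13 = u" "reg s' 3 = ?e" "reg s' 10 = reg s 10" "reg s' 14 = Suc ?e"
      using a ue one by (simp_all add: frame_def mark_prog_def mark_loop_def)
    ultimately show "?P1 s'" using a by simp
  qed (use un in simp_all)
  have 2: "runs W pick_prog s' (15 * n + 4) ?P2" if a: "?P1 s'" for s'
  proof (rule runs_mono[OF runs_frame[OF runs_pick_prog[OF x]]])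
    fix s'' assume b: "picked x u (reg s'' 17) \<and> frame pick_prog s' s''"
    then have "prepared x s''"
      using a by (intro prepared_frame[of x s' _ s'']) (auto simp: pick_prog_def pick_loop_def)
    moreover have "reg s'' 13 = reg s' 13" "reg s'' 3 = reg s' 3" "reg s'' 10 = reg s' 10"
      "reg s'' 14 = reg s' 14" "arr s'' 5 = arr s' 5"
      using b by (simp_all add: frame_def pick_prog_def pick_loop_def)
    ultimately show "?P2 s''" using a b by (simp add: marked_def)
  qed (use a un in simp_all)
  have 3: "runs W test_prog s' (7 * n + 5) ?P3" if a: "?P2 s'" for s'
  proof (rule runs_mono[OF runs_frame[OF runs_test_prog[where u = u and b = "reg s' 17"]]])
    show "reg s' 17 < n" using a picked_less un by blast
    show "arcs_ready s'" using a by (simp add: prepared_def dist_ready_def)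
    fix s'' assume b: "reg s'' 19 = (if nbrs (reg s' 17) \<inter> insert u (nbrs u) = {} then 1 else 0) \<and>
      frame test_prog s' s''"
    then have "prepared x s''"
      using a by (intro prepared_frame[of x s' _ s'']) (auto simp: test_prog_def test_loop_def)
    moreover have "reg s'' 3 = reg s' 3" "reg s'' 10 = reg s' 10" "arr s'' 5 = arr s' 5"
      using b by (simp_all add: frame_def test_prog_def test_loop_def)
    ultimately show "?P3 s''" using a b by auto
  qed (use a in simp_all)
  have 4: "runs W (Seq (If (Less 19 1) Skip (If (Less 1 10) (Move 10 1) Skip)) (Add 3 3 1)) s' 4 ?Q"
    if a: "?P3 s'" for s'
  proof -
    obtain v where v: "picked x u v" "reg s' 19 = (if nbrs v \<inter> insert u (nbrs u) = {} then 1 else 0)"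
      using a by blast
    define D where "D \<longleftrightarrow> nbrs v \<inter> insert u (nbrs u) = {}"
    have r: "reg s' 1 = 1" "reg s' 3 = ?e" "reg s' 10 = reg s 10" "reg s' 19 = (if D then 1 else 0)"
      using a v(2) by (simp_all add: D_def prepared_def dist_ready_def arcs_ready_def input_ready_def)
    let ?c = "Seq (If (Less 19 1) Skip (If (Less 1 10) (Move 10 1) Skip)) (Add 3 3 1)"
    have "witnessed x r0 (Suc ?e) (if D \<and> 1 < reg s 10 then 1 else reg s 10)"
      unfolding D_def
      using witnessed_Suc[OF w v(1)[unfolded u_def] ux[unfolded u_def], folded u_def] .
    moreover have "reg (eval_com ?c s') 10 = (if D \<and> 1 < reg s 10 then 1 else reg s 10)"
      "reg (eval_com ?c s') 3 = Suc ?e" "arr (eval_com ?c s') = arr s'"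
      using r by auto
    moreover have "\<forall>v<n. arr s' 5 v \<le> Suc ?e" using a by blast
    ultimately have "?Q (eval_com ?c s')" by (simp only: simp_thms)
    moreover have "safe W ?c s'" using r W eM by simp
    ultimately show ?thesis by (intro runs_straight) simp_all
  qed
  have 34: "runs W (Seq test_prog (Seq (If (Less 19 1) Skip (If (Less 1 10) (Move 10 1) Skip)) (Add 3 3 1)))
     s' (7 * n + 9) ?Q" if "?P2 s'" for s'
    by (rule runs_Seq[OF 3[OF that] 4]) simp_all
  have 234: "runs W (Seq pick_prog (Seq test_prog (Seq (If (Less 19 1) Skip (If (Less 1 10) (Move 10 1) Skip))
     (Add 3 3 1)))) s' (22 * n + 13) ?Q" if "?P1 s'" for s'
    by (rule runs_Seq[OF 2[OF that] 34]) simp_all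
  show ?thesis
    unfolding cert_loop_def block.simps
    by (rule runs_Seq_straight, simp, simp, rule runs_Seq_straight, use W eM one in simp, simp,
        rule runs_Seq[OF 1 234]) simp_all
qed

lemma runs_cert_prog:
  assumes x: "x < n" and p: "prepared x s" and z: "\<forall>v<n. arr s 5 v = 0"
  shows "runs W cert_prog s (4 + (26 * n + 21) * card (nbrs x))
    (\<lambda>s'. witnessed x (reg s 10) (off (Suc x)) (reg s' 10))"
  unfolding cert_prog_def block.simps
proof (rule runs_Seq_straight, simp, simp,
    rule runs_Seq_straight, use W x p in \<open>simp add: prepared_def dist_ready_def arcs_ready_def input_ready_def\<close>, simp,
    rule runs_Seq_straight, simp, simp)
  let ?s = "eval_com (Load 12 0 5) (eval_com (Add 5 8 1) (eval_com (Load 3 0 8) s))"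
  let ?T = "4 + (26 * n + 21) * card (nbrs x) - cost (Load 3 0 8) - cost (Add 5 8 1) - cost (Load 12 0 5)"
  let ?r0 = "reg s 10"
  let ?I = "\<lambda>s'. off x \<le> reg s' 3 \<and> reg s' 3 \<le> off (Suc x) \<and> witnessed x ?r0 (reg s' 3) (reg s' 10) \<and>
     (\<forall>v<n. arr s' 5 v \<le> reg s' 3)"
  have p': "prepared x ?s"
    using p by (simp add: prepared_def dist_ready_def arcs_ready_def input_ready_def)
  have s0: "reg ?s 3 = off x" "reg ?s 12 = off (Suc x)" "reg ?s 10 = ?r0" "arr ?s 5 = arr s 5"
    using p x by (simp_all add: prepared_def dist_ready_def arcs_ready_def input_ready_def)
  have le: "off x \<le> off (Suc x)" by (rule off_mono) simp
  show "runs W (While (Less 3 12) cert_loop) ?s ?T (\<lambda>s'. witnessed x ?r0 (off (Suc x)) (reg s' 10))"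
  proof (rule runs_While[where N = "card (nbrs x)" and \<mu> = "\<lambda>s'. off (Suc x) - reg s' 3" and I = ?I
        and K = "26 * n + 20"])
    show "?I ?s" using z le unfolding s0 by (simp add: witnessed_def)
    show "off (Suc x) - reg ?s 3 \<le> card (nbrs x)" unfolding s0 card_nbrs[OF x] by simp
    fix s' assume I: "?I s'" and f: "frame cert_loop ?s s'" and h: "holds (Less 3 12) s'"
    have r: "prepared x s'"
      by (rule prepared_frame[OF p' f])
        (simp_all add: cert_loop_def mark_prog_def mark_loop_def pick_prog_def pick_loop_def test_prog_def test_loop_def)
    have "reg s' 12 = off (Suc x)" using f s0
      by (simp add: frame_def cert_loop_def mark_prog_def mark_loop_def pick_prog_def pick_loop_def test_prog_def test_loop_def)
    then have l: "reg s' 3 < off (Suc x)" using h by simp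
    show "runs W cert_loop s' (26 * n + 20) (\<lambda>s''. ?I s'' \<and> off (Suc x) - reg s'' 3 < off (Suc x) - reg s' 3)"
    proof (rule runs_mono[OF runs_cert_loop[OF x r]])
      show "witnessed x ?r0 (reg s' 3) (reg s' 10)" using I by blast
    qed (use I l in simp_all)
  next
    fix s' assume I: "?I s'" and f: "frame cert_loop ?s s'" and h: "\<not> holds (Less 3 12) s'"
    have "reg s' 12 = off (Suc x)" using f s0
      by (simp add: frame_def cert_loop_def mark_prog_def mark_loop_def pick_prog_def pick_loop_def test_prog_def test_loop_def)
    then have "reg s' 3 = off (Suc x)" using I h by simp
    then show "witnessed x ?r0 (off (Suc x)) (reg s' 10)" using I by simp
  qed simp
qed

end

section \<open>From the computed value to the diameter\<close>

context min_degree_vertex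
begin

text \<open>The interface between the classes and the program: distances above 3 show in the
  eccentricity of \<open>x\<close>, distances above 2 there or in a certificate.\<close>

definition tractable :: bool where
  "tractable \<longleftrightarrow> (\<forall>u \<in> pverts G. \<forall>v \<in> pverts G. near 4 u v \<and>
     (\<not> near 3 u v \<longrightarrow> (\<exists>w \<in> pverts G. \<not> near 3 x w)) \<and>
     (\<not> near 2 u v \<longrightarrow> (\<exists>w \<in> pverts G. \<not> near 2 x w) \<or> (\<exists>u \<in> nbrs x. certificate x u)))"

lemma tractable_if_induced_free:
  fixes H :: "'h pair_pre_digraph"
  assumes H: "pair_graph H" and free: "induced_free H G"
    and sub: "induced_in H (disj_union (path_graph 2) (copies 2 (path_graph 1)))
       \<or> induced_in H (disj_union (path_graph 3) (path_graph 1))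
       \<or> induced_in H (path_graph 4)"
  shows tractable
proof -
  have wfH: "pair_wf_digraph H"
    using H by (simp add: pair_graph_def pair_digraph_def pair_fin_digraph_def)
  note no_embedding = induced_free_no_embedding[OF wfH pair_wf_digraph_axioms _ free]
  from sub consider
      (D) "induced_in H (disj_union (path_graph 2) (copies 2 (path_graph 1)))"
    | (P) "induced_in H (disj_union (path_graph 3) (path_graph 1))"
    | (C) "induced_in H (path_graph 4)" by blast
  then show ?thesis
  proof cases
    case D
    interpret D: co_diamond_free G x
    proof
      fix a b c d
      assume *: "(a, b) \<in> parcs G" "c \<in> pverts G" "d \<in> pverts G" "c \<noteq> d" "(c, d) \<notin> parcs G"
        "c \<notin> {a, b}" "d \<notin> {a, b}" "(a, c) \<notin> parcs G" "(b, c) \<notin> parcs G"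
        "(a, d) \<notin> parcs G" "(b, d) \<notin> parcs G"
      from embeds_co_diamond[OF *] no_embedding[OF D] show False by blast
    qed
    show ?thesis
      unfolding tractable_def using D.near_4_all D.far_3_minimal D.far_2_certificate by blast
  next
    case P
    interpret P: co_paw_free G x
    proof
      fix a b c d
      assume *: "(a, b) \<in> parcs G" "(b, c) \<in> parcs G" "a \<noteq> c" "(a, c) \<notin> parcs G"
        "d \<in> pverts G" "d \<notin> {a, b, c}" "(a, d) \<notin> parcs G" "(b, d) \<notin> parcs G" "(c, d) \<notin> parcs G"
      from embeds_co_paw[OF *] no_embedding[OF P] show False by blast
    qed
    have "near 4 u v" "near 3 u v" if "u \<in> pverts G" "v \<in> pverts G" for u v
      using P.near_3_all[OF that] by (simp_all add: near_4)
    then show ?thesis unfolding tractable_def using P.far_2_minimal by blast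
  next
    case C
    have "near 2 u v" if "u \<in> pverts G" "v \<in> pverts G" for u v
    proof (rule cograph_near_2[OF _ that])
      fix a b c d
      assume *: "(a, b) \<in> parcs G" "(b, c) \<in> parcs G" "(c, d) \<in> parcs G" "distinct [a, b, c, d]"
        "(a, c) \<notin> parcs G" "(a, d) \<notin> parcs G" "(b, d) \<notin> parcs G"
      from embeds_path_4[OF *] no_embedding[OF C] show False by blast
    qed
    then show ?thesis unfolding tractable_def by (simp add: near_3 near_4)
  qed
qed

text \<open>\<open>r0\<close> and \<open>r\<close> are the values of register 10 before and after the search for certificates:
  4 minus the eccentricity of \<open>x\<close>, and 4 minus the diameter.\<close>

lemma diameter_if_tractable:
  assumes t: tractable
    and ecc: "r0 \<le> 4" "\<And>k. k \<le> 3 \<Longrightarrow> 4 - k \<le> r0 \<longleftrightarrow> (\<forall>w \<in> pverts G. near k x w)"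
    and le: "r \<le> r0"
    and sound: "r < r0 \<Longrightarrow> r = 1 \<and> (\<exists>u \<in> pverts G. \<exists>v \<in> pverts G. \<not> near 2 u v)"
    and complete: "\<And>u. u \<in> nbrs x \<Longrightarrow> certificate x u \<Longrightarrow> r \<le> 1"
  shows "diameter G = ereal (real (4 - r))"
proof (rule diameter_eqI)
  fix u v assume uv: "u \<in> pverts G" "v \<in> pverts G"
  have ecc': "near k x w" if "k \<le> 3" "4 - k \<le> r" "w \<in> pverts G" for k w
    using ecc(2)[OF that(1)] that(2,3) le by auto
  consider "r = 0" | "r = 1" | "r = 2" | "r = 3" | "r = 4" using ecc(1) le by linarith
  then show "near (4 - r) u v"
  proof cases
    case 1
    then show ?thesis using t uv by (simp add: tractable_def)
  next
    case 2
    then have "\<forall>w \<in> pverts G. near 3 x w" using ecc'[of 3] by simp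
    then have "near 3 u v" using t uv unfolding tractable_def by blast
    then show ?thesis using 2 by simp
  next
    case 3
    then have "\<forall>w \<in> pverts G. near 2 x w" using ecc'[of 2] by simp
    \<comment> \<open>A certificate would have brought \<open>r\<close> down to at most 1.\<close>
    moreover have "\<not> certificate x u'" if "u' \<in> nbrs x" for u' using complete[OF that] 3 by auto
    ultimately have "near 2 u v" using t uv unfolding tractable_def by blast
    then show ?thesis using 3 by simp
  next
    case 4
    then show ?thesis using near_1_all[OF ecc'[of 1]] uv by simp
  next
    case 5
    then show ?thesis using ecc'[of 0 u] ecc'[of 0 v] uv by simp
  qed
next
  assume pos: "0 < 4 - r"
  show "\<exists>u \<in> pverts G. \<exists>v \<in> pverts G. \<not> near (4 - r - 1) u v"
  proof (cases "r < r0")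
    case True
    then show ?thesis using sound by simp
  next
    case False
    \<comment> \<open>Here \<open>r = r0\<close>, and the far pair consists of \<open>x\<close> and
      a vertex realising its eccentricity.\<close>
    then have "\<not> 4 - (4 - r - 1) \<le> r0" using le pos by simp
    then show ?thesis using ecc(2)[of "4 - r - 1"] x_in by auto
  qed
qed

end

section \<open>Size of the input and the complete run\<close>

context ram_input
begin

text \<open>The degree sum is \<open>M\<close>; this is what makes work linear in \<open>n\<close>
  affordable for every neighbour of \<open>x\<close>.\<close>

lemma min_degree_times_n: "(\<And>v. v < n \<Longrightarrow> d \<le> card (nbrs v)) \<Longrightarrow> n * d \<le> M"
proof -
  assume d: "\<And>v. v < n \<Longrightarrow> d \<le> card (nbrs v)"
  have "v * d \<le> off v" if "v \<le> n" for v
    using that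
  proof (induction v)
    case (Suc v)
    then have "v * d \<le> off v" "d \<le> off (Suc v) - off v" using d[of v] card_nbrs[of v] by auto
    moreover have "off v \<le> off (Suc v)" by (rule off_mono) simp
    ultimately show ?case by simp
  qed simp
  from this[of n] show ?thesis by (simp add: off_n)
qed

text \<open>Addresses inject into arcs. Swapping the ends matches increasing with decreasing arcs,
  and the increasing ones inject into the edges.\<close>

lemma M_le_edges: "M \<le> 2 * card (edges G)"
proof -
  let ?L = "{(u, v). (u, v) \<in> parcs G \<and> u < v}" and ?R = "{(u, v). (u, v) \<in> parcs G \<and> v < u}"
  have fin: "finite ?L" "finite ?R" by (rule finite_subset[OF _ pair_finite_arcs]; auto)+
  have "inj_on (\<lambda>e. (src e, tgt e)) {..<M}"
  proof (rule inj_onI)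
    fix e e' assume e: "e \<in> {..<M}" "e' \<in> {..<M}" "(src e, tgt e) = (src e', tgt e')"
    then have "e \<in> {off (src e)..<off (Suc (src e))}" "e' \<in> {off (src e)..<off (Suc (src e))}"
      using src[of e] src[of e'] by auto
    then show "e = e'"
      using bij_tgt[OF src(1)[of e]] e unfolding bij_betw_def by (auto dest: inj_onD)
  qed
  then have "card {..<M} \<le> card (parcs G)"
    by (rule card_inj_on_le) (use arc_iff pair_finite_arcs in auto)
  also have "parcs G = ?L \<union> ?R" using no_loop by (auto simp: neq_iff) (metis nat_neq_iff no_loop)
  also have "card (?L \<union> ?R) \<le> card ?L + card ?R" by (rule card_Un_le)
  also have "card ?R = card ?L"
    by (rule bij_betw_same_card[of prod.swap]) (auto simp: bij_betw_def inj_on_def image_iff parcs_sym)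
  also have "card ?L \<le> card (edges G)"
  proof (rule card_inj_on_le[of "\<lambda>(u, v). {u, v}"])
    show "inj_on (\<lambda>(u, v). {u, v}) ?L" by (auto simp: inj_on_def doubleton_eq_iff)
    show "finite (edges G)" unfolding edges_def using pair_finite_arcs by simp
  qed (auto simp: edges_def)
  finally show ?thesis by simp
qed

definition ecc_ready :: "nat \<Rightarrow> nat \<Rightarrow> bool" where
  "ecc_ready x r \<longleftrightarrow> (\<forall>v<n. r \<le> 4 - hops x v) \<and> (\<exists>v<n. r = 4 - hops x v)"

text \<open>What a finished run says about its output, free of machine states, so that graph theory
  can take over.\<close>

definition result :: "nat \<Rightarrow> bool" where
  "result d \<longleftrightarrow> (\<exists>x r0 r. x < n \<and> (\<forall>v<n. card (nbrs x) \<le> card (nbrs v)) \<and> ecc_ready x r0 \<and>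
     witnessed x r0 (off (Suc x)) r \<and> d = 4 - r)"

lemma runs_after_min:
  assumes x: "x < n" and min: "\<forall>v<n. card (nbrs x) \<le> card (nbrs v)"
    and s: "arcs_ready s" "reg s 8 = x" "\<forall>a \<in> {3, 4, 5}. arr s a = (\<lambda>_. 0)"
  shows "runs W (block [Const 5 4, Store 3 8 5, relax_prog, relax_prog, relax_prog, ecc_prog, outer_prog,
     cert_prog, Const 5 4, Sub 0 5 10]) s (93 * M + 6 * n + 20) (\<lambda>s'. result (reg s' 0))"
proof -
  let ?Q = "\<lambda>s'. result (reg s' 0)"
  let ?c1 = "block [cert_prog, Const 5 4, Sub 0 5 10]"
  let ?c2 = "block [outer_prog, cert_prog, Const 5 4, Sub 0 5 10]"
  let ?c3 = "block [ecc_prog, outer_prog, cert_prog, Const 5 4, Sub 0 5 10]"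
  let ?c4 = "block [relax_prog, ecc_prog, outer_prog, cert_prog, Const 5 4, Sub 0 5 10]"
  let ?c5 = "block [relax_prog, relax_prog, ecc_prog, outer_prog, cert_prog, Const 5 4, Sub 0 5 10]"
  let ?c6 = "block [relax_prog, relax_prog, relax_prog, ecc_prog, outer_prog, cert_prog, Const 5 4, Sub 0 5 10]"
  \<comment> \<open>Counting and stamping rely on arrays 4 and 5 still being zero when they
    start.\<close>
  let ?z = "\<lambda>s. arr s 4 = (\<lambda>_. 0) \<and> arr s 5 = (\<lambda>_. 0)"
  have "n * card (nbrs x) \<le> M" using min by (intro min_degree_times_n) simp
  moreover have "1 \<le> n" using n_pos by linarith
  from mult_le_mono1[OF this, of "card (nbrs x)"] have "card (nbrs x) \<le> n * card (nbrs x)" by simp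
  moreover have "(26 * n + 21) * card (nbrs x) = 26 * (n * card (nbrs x)) + 21 * card (nbrs x)"
    by (simp add: add_mult_distrib mult.assoc)
  \<comment> \<open>Here 47 is 26 + 21: both \<open>n\<close> times the degree of \<open>x\<close>
    and the degree itself are at most \<open>M\<close>.\<close>
  ultimately have time: "(26 * n + 21) * card (nbrs x) \<le> 47 * M" by linarith
  have 1: "runs W ?c1 s (47 * M + 6) ?Q"
    if "prepared x s" "ecc_ready x (reg s 10)" "arr s 5 = (\<lambda>_. 0)" for s
    unfolding block.simps
  proof (rule runs_Seq[OF runs_cert_prog[OF x that(1)]])
    show "runs W (Seq (Const 5 4) (Sub 0 5 10)) s' 2 ?Q"
      if "witnessed x (reg s 10) (off (Suc x)) (reg s' 10)" for s'
    proof (rule runs_straight)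
      show "result (reg (eval_com (Seq (Const 5 4) (Sub 0 5 10)) s') 0)"
        unfolding result_def using x min that \<open>ecc_ready x (reg s 10)\<close>
        by (intro exI[of _ x] exI[of _ "reg s 10"] exI[of _ "reg s' 10"]) simp
    qed (use W in simp_all)
  qed (use that time in simp_all)
  have 2: "runs W ?c2 s (57 * M + 9) ?Q" if "dist_ready x s" "ecc_ready x (reg s 10)" "?z s" for s
    unfolding block.simps(3)[of outer_prog]
  proof (rule runs_Seq[OF runs_frame[OF runs_outer_prog[OF x that(1)]] 1])
    fix s' assume a: "prepared x s' \<and> frame outer_prog s s'"
    then have "reg s' 10 = reg s 10" "arr s' 5 = arr s 5"
      by (simp_all add: frame_def outer_prog_def outer_loop_def)
    then show "ecc_ready x (reg s' 10)" "arr s' 5 = (\<lambda>_. 0)" using that by simp_all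
  qed (use that in simp_all)
  have 3: "runs W ?c3 s (57 * M + 6 * n + 12) ?Q" if "dist_ready x s" "?z s" for s
    unfolding block.simps(3)[of ecc_prog]
  proof (rule runs_Seq[OF runs_frame[OF runs_ecc_prog[OF x that(1)]] 2])
    fix s' assume a: "(dist_ready x s' \<and> (\<forall>v<n. reg s' 10 \<le> 4 - hops x v) \<and>
      (\<exists>v<n. reg s' 10 = 4 - hops x v)) \<and> frame ecc_prog s s'"
    then have "arr s' 4 = arr s 4" "arr s' 5 = arr s 5"
      by (simp_all add: frame_def ecc_prog_def ecc_loop_def)
    then show "?z s'" using that by simp
    show "ecc_ready x (reg s' 10)" using a by (simp add: ecc_ready_def)
  qed simp_all
  have relax: "runs W relax_prog s (12 * M + 2) (\<lambda>s'. level x (Suc i) s' \<and> ?z s')"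
    if "level x i s" "?z s" for i s
    by (rule runs_mono[OF runs_frame[OF runs_relax_prog[OF x that(1)]]])
      (use that(2) in \<open>simp_all add: frame_def relax_prog_def relax_loop_def\<close>)
  have 4: "runs W ?c4 s (69 * M + 6 * n + 14) ?Q" if "level x 2 s" "?z s" for s
    unfolding block.simps(3)[of relax_prog]
    by (rule runs_Seq[OF relax[OF that] 3]) (simp_all add: level_3)
  have 5: "runs W ?c5 s (81 * M + 6 * n + 16) ?Q" if "level x 1 s" "?z s" for s
    unfolding block.simps(3)[of relax_prog relax_prog]
    by (rule runs_Seq[OF relax[OF that] 4]) (simp_all add: numeral_2_eq_2)
  have 6: "runs W ?c6 s (93 * M + 6 * n + 18) ?Q" if "level x 0 s" "?z s" for s
    by (subst block.simps(3), rule runs_Seq[OF relax[OF that] 5]) simp_all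
  let ?s = "eval_com (Store 3 8 5) (eval_com (Const 5 4) s)"
  have hops0: "v = x" if "v < n" "hops x v \<le> 0" for v
    using near_hops[OF x that(1), of 0] that(2) by simp
  have hopsx: "hops x x = 0" using near_hops[OF x x, of 0] by simp
  have "arcs_ready ?s" "reg ?s 8 = x" "arr ?s 3 = (\<lambda>v. if v = x then 4 else 0)"
    using s by (auto simp: arcs_ready_def input_ready_def)
  then have "level x 0 ?s"
    unfolding level_def using hops0 hopsx by simp
  moreover have "?z ?s" using s by simp
  ultimately have "runs W ?c6 ?s (93 * M + 6 * n + 18) ?Q" by (rule 6)
  note main = this[unfolded block.simps]
  show ?thesis
    unfolding block.simps
    by (rule runs_Seq_straight, use W in simp, simp, rule runs_Seq_straight, simp, simp,
        rule runs_mono[OF main]) simp_all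
qed

lemma runs_diameter_prog:
  "runs W diameter_prog (input_state adj) (103 * (n + M)) (\<lambda>s'. result (reg s' 0))"
proof -
  let ?s = "eval_com (Load 2 0 0) (eval_com (Const 1 1) (input_state adj))"
  let ?z = "\<lambda>s. \<forall>a \<in> {3, 4, 5}. arr s a = (\<lambda>_. 0)"
  let ?cs = "[Const 5 4, Store 3 8 5, relax_prog, relax_prog, relax_prog, ecc_prog, outer_prog,
     cert_prog, Const 5 4, Sub 0 5 10]"
  let ?Q = "\<lambda>s'. result (reg s' 0)"
  have ready: "input_ready ?s" "?z ?s"
    by (simp_all add: input_ready_def input_state_def off_def tgt_def)
  have min: "runs W (Seq min_prog (block ?cs)) s (93 * M + 18 * n + 24) ?Q"
    if "arcs_ready s" "?z s" for s
  proof (rule runs_Seq[OF runs_frame[OF runs_min_prog[OF that(1)]]])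
    fix s' assume a: "(arcs_ready s' \<and> reg s' 8 < n \<and> (\<forall>v<n. card (nbrs (reg s' 8)) \<le> card (nbrs v))) \<and>
      frame min_prog s s'"
    have z: "?z s'" using a that(2) by (simp add: frame_def min_prog_def min_loop_def)
    show "runs W (block ?cs) s' (93 * M + 6 * n + 20) ?Q"
      by (rule runs_after_min[of "reg s' 8", OF _ _ _ refl z]) (use a in simp_all)
  qed simp
  have "runs W (Seq src_prog (Seq min_prog (block ?cs))) ?s (103 * M + 28 * n + 27) ?Q"
  proof (rule runs_Seq[OF runs_frame[OF runs_src_prog[OF ready(1)]] min])
    fix s' assume "arcs_ready s' \<and> frame src_prog ?s s'"
    then show "?z s'" using ready(2) by (simp add: frame_def src_prog_def src_loop_def)
  qed simp_all
  note main = this[unfolded block.simps]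
  have "runs W diameter_prog (input_state adj) (103 * M + 28 * n + 29) ?Q"
    unfolding diameter_prog_def block.simps
    by (rule runs_Seq_straight, use W in simp, simp, rule runs_Seq_straight, simp, simp,
        rule runs_mono[OF main]) simp_all
  \<comment> \<open>Since \<open>n\<close> is positive, the additive constant is absorbed.\<close>
  moreover have "1 \<le> n" using n_pos by linarith
  then have "103 * M + 28 * n + 29 \<le> 103 * (n + M)" by presburger
  ultimately show ?thesis by (rule runs_mono) simp
qed

lemma result_imp_diameter:
  fixes H :: "'h pair_pre_digraph"
  assumes H: "pair_graph H" and free: "induced_free H G"
    and sub: "induced_in H (disj_union (path_graph 2) (copies 2 (path_graph 1)))
       \<or> induced_in H (disj_union (path_graph 3) (path_graph 1))
       \<or> induced_in H (path_graph 4)"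
    and "result d"
  shows "diameter G = ereal (real d)"
proof -
  obtain x r0 r where x: "x < n" and min: "\<forall>v<n. card (nbrs x) \<le> card (nbrs v)"
    and ecc: "ecc_ready x r0" and w: "witnessed x r0 (off (Suc x)) r" and d: "d = 4 - r"
    using \<open>result d\<close> unfolding result_def by blast
  interpret X: min_degree_vertex G x
    by unfold_locales (use x min pverts_eq in auto)
  show ?thesis
    unfolding d
  proof (rule X.diameter_if_tractable[OF X.tractable_if_induced_free[OF H free sub]])
    show "r0 \<le> 4" using ecc by (auto simp: ecc_ready_def)
    fix k :: nat assume k: "k \<le> 3"
    show "4 - k \<le> r0 \<longleftrightarrow> (\<forall>w \<in> pverts G. near k x w)"
    proof
      assume a: "4 - k \<le> r0"
      show "\<forall>w \<in> pverts G. near k x w"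
      proof
        fix w assume "w \<in> pverts G"
        then have w: "w < n" by (simp add: pverts_eq)
        then have "r0 \<le> 4 - hops x w" using ecc unfolding ecc_ready_def by blast
        then have "hops x w \<le> k" using a k by linarith
        then show "near k x w" using near_hops[OF x w] by simp
      qed
    next
      assume a: "\<forall>w \<in> pverts G. near k x w"
      obtain v where v: "v < n" "r0 = 4 - hops x v" using ecc unfolding ecc_ready_def by blast
      have "near k x v" using a v(1) by (simp add: pverts_eq)
      then have "hops x v \<le> k" using near_hops[OF x v(1)] by simp
      then show "4 - k \<le> r0" using v(2) by simp
    qed
  next
    show "r \<le> r0" using w by (simp add: witnessed_def)
    show "r = 1 \<and> (\<exists>u \<in> pverts G. \<exists>v \<in> pverts G. \<not> near 2 u v)" if "r < r0"
      using w that unfolding witnessed_def by blast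
    fix u assume "u \<in> nbrs x" "certificate x u"
    then obtain e where "off x \<le> e" "e < off (Suc x)" "tgt e = u"
      unfolding tgt_image[OF x, symmetric] by auto
    then show "r \<le> 1" using w \<open>certificate x u\<close> unfolding witnessed_def by blast
  qed
qed

end

theorem theorem3:
  fixes H :: "'h pair_pre_digraph"
  assumes "pair_graph H"
    and "induced_in H (disj_union (path_graph 2) (copies 2 (path_graph 1)))
       \<or> induced_in H (disj_union (path_graph 3) (path_graph 1))
       \<or> induced_in H (path_graph 4)"
  shows "diameter_in_linear_time (induced_free H)"
  unfolding diameter_in_linear_time_def Let_def
proof (rule exI[of _ diameter_prog], rule exI[of _ 206], rule exI[of _ 2], intro allI impI)
  \<comment> \<open>The factor 206 is twice 103, as the number of arcs is at most twice the number
    of edges.\<close>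
  fix G :: "nat pair_pre_digraph" and adj
  assume G: "pair_graph G" "connected (with_proj G)" and free: "induced_free H G"
    and adj: "adjacency_lists G adj"
  interpret connected_pair_graph G
    using G by (simp add: connected_pair_graph_def connected_pair_graph_axioms_def)
  define n where "n = card (pverts G)"
  define m where "m = card (edges G)"
  define W where "W = (n + m + 2)\<^sup>2"
  have n: "n = length adj" using adj by (simp add: n_def adjacency_lists_def)
  have n_pos: "0 < n" using pverts_nonempty pair_finite_verts by (simp add: n_def card_gt_0_iff)
  \<comment> \<open>The bound on the number of arcs is needed to see that \<open>W\<close> is large
    enough, so the locale is first entered with its smallest admissible word bound.\<close>
  interpret arcs: ram_input G adj "length adj + length (concat adj) + 7"
    by unfold_locales (use adj in simp_all)
  have M: "length (concat adj) \<le> 2 * m" using arcs.M_le_edges by (simp add: m_def)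
  \<comment> \<open>The square exceeds \<open>4 * n + 4 * m + 4\<close>, and as \<open>n\<close> is
    at least 1 this covers both the doubled \<open>m\<close> and the constant 7.\<close>
  have "(n + m + 2)\<^sup>2 = (n + m)\<^sup>2 + 4 * (n + m) + 4" by (simp add: power2_eq_square algebra_simps)
  then have "4 * n + 4 * m + 4 \<le> W" unfolding W_def by simp
  moreover have "1 \<le> n" using n_pos by linarith
  ultimately have "n + 2 * m + 7 \<le> W" by linarith
  then have W: "length adj + length (concat adj) + 7 \<le> W" using M n by linarith
  interpret ram_input G adj W by unfold_locales (rule adj, rule W)
  obtain t s' where e: "exec W diameter_prog (input_state adj) t s'"
    and t: "t \<le> 103 * (length adj + length (concat adj))" and r: "result (reg s' 0)"
    using runs_diameter_prog unfolding runs_def by blast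
  have "length adj + length (concat adj) \<le> 2 * (n + m)" using M n by simp
  then have "103 * (length adj + length (concat adj)) \<le> 103 * (2 * (n + m))" by (rule mult_le_mono2)
  then have "t \<le> 206 * (n + m)" using t by simp
  moreover have "ereal (real (reg s' 0)) = diameter G"
    using result_imp_diameter[OF assms(1) free assms(2) r] by simp
  ultimately show "\<exists>t s'. exec ((card (pverts G) + card (edges G) + 2)\<^sup>2) diameter_prog (input_state adj) t s' \<and>
     t \<le> 206 * (card (pverts G) + card (edges G)) \<and> ereal (real (reg s' 0)) = diameter G"
    using e unfolding W_def n_def m_def by blast
qed

end
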